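(* Let $K$ be a convex body in $\mathbb{R}^2$, and let $\varepsilon\in[0,1)$. If $\delta_{\rm BM}(K,T^2)\ge\varepsilon$, then $$\mathrm{ir}(K)\le (1-\gamma\varepsilon)\,\mathrm{ir}(T^2),$$ where one can choose $\gamma=2^{-3}3^{-2}$.
   Context: A convex body is a compact convex set with non-empty interior; in the plane $V$ denotes area and $S$ denotes perimeter. $T^2$ is a regular triangle circumscribed about the unit disc $B^2$ centred at the origin (every edge is tangent to $B^2$, and $B^2\subset T^2$). For a convex body $K$ in $\mathbb{R}^2$, $$\mathrm{ir}(K)=\inf\left\{\frac{S(\Phi K)^2}{V(\Phi K)}:\ \Phi\in{\rm GL}(2)\right\}.$$ The Banach-Mazur distance of convex bodies $K,M$ in $\mathbb{R}^2$ is $$\delta_{\rm BM}(K,M)=\ln\min\{\lambda\ge 1:\ K-x\subset \Phi(M-y)\subset\lambda(K-x)\ \text{for some }\Phi\in{\rm GL}(2),\ x,y\in\mathbb{R}^2\}.$$ *)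

theory Defs
  imports "HOL-Analysis.Analysis"
begin

definition convex_body :: "(real^2) set \<Rightarrow> bool" where
  "convex_body K \<longleftrightarrow> convex K \<and> compact K \<and> interior K \<noteq> {}"

definition area :: "(real^2) set \<Rightarrow> real" where
  "area K = measure lebesgue K"

text \<open>
  One-dimensional Hausdorff measure, with the normalisation under which a segment has measure
  equal to its length. The covering sets are required to be bounded because \<^const>\<open>diameter\<close>
  is meaningless on unbounded sets; empty sets, of diameter 0, make finite covers admissible.
\<close>

definition hausdorff_premeasure_1 :: "real \<Rightarrow> 'a::metric_space set \<Rightarrow> ennreal" where
  "hausdorff_premeasure_1 d A =
     (INF U\<in>{U :: nat \<Rightarrow> 'a set. A \<subseteq> (\<Union>n. U n) \<and> (\<forall>n. bounded (U n) \<and> diameter (U n) \<le> d)}.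
        \<Sum>n. ennreal (diameter (U n)))"

definition hausdorff_measure_1 :: "'a::metric_space set \<Rightarrow> ennreal" where
  "hausdorff_measure_1 A = (SUP d\<in>{0<..}. hausdorff_premeasure_1 d A)"

text \<open>
  The perimeter is the length of the boundary. It is finite for every bounded convex set, so
  \<^const>\<open>enn2real\<close> loses nothing on convex bodies.
\<close>

definition perimeter :: "(real^2) set \<Rightarrow> real" where
  "perimeter K = enn2real (hausdorff_measure_1 (frontier K))"

definition ir :: "(real^2) set \<Rightarrow> real" where
  "ir K = (INF A\<in>{A :: real^2^2. invertible A}.
             (perimeter ((*v) A ` K))\<^sup>2 / area ((*v) A ` K))"

text \<open>
  For convex bodies the minimum over \<open>\<lambda>\<close> is attained by compactness, so it equals the
  infimum used here.
\<close>

definition banach_mazur :: "(real^2) set \<Rightarrow> (real^2) set \<Rightarrow> real" where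
  "banach_mazur K M = ln (Inf {l :: real. 1 \<le> l \<and>
     (\<exists>(A :: real^2^2) x y. invertible A \<and>
        (\<lambda>z. z - x) ` K \<subseteq> (*v) A ` ((\<lambda>z. z - y) ` M) \<and>
        (*v) A ` ((\<lambda>z. z - y) ` M) \<subseteq> (*\<^sub>R) l ` ((\<lambda>z. z - x) ` K))})"

definition tangent_to_unit_disc :: "real^2 \<Rightarrow> real^2 \<Rightarrow> bool" where
  "tangent_to_unit_disc a b \<longleftrightarrow>
     (\<exists>p \<in> closed_segment a b. affine hull {a, b} \<inter> cball 0 1 = {p})"

definition regular_triangle_circumscribing_unit_disc :: "(real^2) set \<Rightarrow> bool" where
  "regular_triangle_circumscribing_unit_disc T \<longleftrightarrow>
     (\<exists>a b c. T = convex hull {a, b, c} \<and>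
        a \<noteq> b \<and> dist a b = dist b c \<and> dist b c = dist c a \<and>
        cball 0 1 \<subseteq> T \<and>
        tangent_to_unit_disc a b \<and> tangent_to_unit_disc b c \<and> tangent_to_unit_disc c a)"

end

theory Submission
  imports Defs
begin

text \<open>
  The idea is to compare \<open>K\<close> with the largest triangle \<open>abc\<close> that it contains. After a linear map \<open>abc\<close> is
  regular with side 1. Let \<open>t\<close> be the sum of the distances by which \<open>K\<close> reaches beyond the three
  sides, in units of the height of \<open>abc\<close>. Then

    \<^item> the perimeter is at most \<open>3 + t\<close>: as \<open>abc\<close> has largest area, \<open>K\<close> lies between the lines through each
      vertex parallel to the opposite side and the support lines parallel to the sides, and this
      hexagon has perimeter \<open>3 + t\<close>;
    \<^item> the area is at least \<open>1 + t\<close> times the area \<open>\<surd>3 / 4\<close> of \<open>abc\<close>: \<open>K\<close> contains \<open>abc\<close> and a triangle erected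
      over each side;
    \<^item> \<open>K\<close> lies in a homothetic copy of \<open>abc\<close> of ratio \<open>1 + t\<close>, so its Banach--Mazur distance to a triangle is
      at most \<open>ln (1 + t) \<le> t\<close>; hence \<open>t \<ge> \<epsilon>\<close>;
    \<^item> \<open>t \<le> 5 / 2\<close>, again because \<open>abc\<close> has largest area.

  These are collected in \<open>normalized_body_bounds\<close> and \<open>banach_mazur_triangle_le\<close>. The first two give
  \<open>ir K \<le> (4 / \<surd>3) (3 + t)\<^sup>2 / (1 + t) = 12 \<surd>3 (1 - t (3 - t) / (9 (1 + t)))\<close>, and the last two make the
  deficit at least \<open>\<epsilon> / 72\<close> (\<open>isoperimetric_ratio_estimate\<close>). On the other side \<open>ir T \<ge> 12 \<surd>3\<close> for every
  triangle, by Heron's formula (\<open>ir_triangle_ge\<close>).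

  Perimeter is the Hausdorff measure of the boundary, so two facts about it are proved from
  the definition: the perimeter of a triangle is the sum of its side lengths (\<open>perimeter_triangle\<close>), and
  perimeter is monotone on convex sets, since the nearest point map does not expand distances
  (\<open>hausdorff_measure_1_frontier_convex_le\<close>).
\<close>

section \<open>One-dimensional Hausdorff measure\<close>


lemma hausdorff_premeasure_1_le:
  assumes "A \<subseteq> (\<Union>n. U n)" "\<And>n. bounded (U n)" "\<And>n. diameter (U n) \<le> d"
  shows "hausdorff_premeasure_1 d A \<le> (\<Sum>n. ennreal (diameter (U n)))"
  unfolding hausdorff_premeasure_1_def using assms by (intro INF_lower) auto

lemma hausdorff_premeasure_1_geI:
  assumes "\<And>U :: nat \<Rightarrow> 'a::metric_space set. A \<subseteq> (\<Union>n. U n) \<Longrightarrow> (\<And>n. bounded (U n)) \<Longrightarrow>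
      (\<And>n. diameter (U n) \<le> d) \<Longrightarrow> x \<le> (\<Sum>n. ennreal (diameter (U n)))"
  shows "x \<le> hausdorff_premeasure_1 d A"
  unfolding hausdorff_premeasure_1_def using assms by (intro INF_greatest) auto

lemma hausdorff_premeasure_1_antimono:
  assumes "d \<le> e"
  shows "hausdorff_premeasure_1 e A \<le> hausdorff_premeasure_1 d A"
  using assms by (intro hausdorff_premeasure_1_geI hausdorff_premeasure_1_le) (auto intro: order_trans)

lemma hausdorff_measure_1_leI:
  assumes "\<And>d. d > 0 \<Longrightarrow> hausdorff_premeasure_1 d A \<le> x"
  shows "hausdorff_measure_1 A \<le> x"
  unfolding hausdorff_measure_1_def using assms by (intro SUP_least) auto

lemma hausdorff_premeasure_1_le_measure:
  "d > 0 \<Longrightarrow> hausdorff_premeasure_1 d A \<le> hausdorff_measure_1 A"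
  unfolding hausdorff_measure_1_def by (intro SUP_upper) auto

lemma hausdorff_measure_1_mono:
  assumes "A \<subseteq> B"
  shows "hausdorff_measure_1 A \<le> hausdorff_measure_1 B"
proof (rule hausdorff_measure_1_leI)
  fix d :: real assume d: "d > 0"
  have "hausdorff_premeasure_1 d A \<le> hausdorff_premeasure_1 d B"
    using assms by (intro hausdorff_premeasure_1_geI hausdorff_premeasure_1_le) auto
  then show "hausdorff_premeasure_1 d A \<le> hausdorff_measure_1 B"
    using hausdorff_premeasure_1_le_measure[OF d] order_trans by blast
qed

text \<open>
  Splitting a lower bound over two independent infima: this is what allows the covers of two sets
  to be chosen separately when their premeasures are added.
\<close>

lemma ennreal_le_INF_add_INF:
  fixes f :: "'i \<Rightarrow> ennreal" and g :: "'j \<Rightarrow> ennreal"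
  assumes le: "\<And>i j. i \<in> I \<Longrightarrow> j \<in> J \<Longrightarrow> c \<le> f i + g j"
  shows "c \<le> (INF i\<in>I. f i) + (INF j\<in>J. g j)"
proof (rule ccontr)
  assume "\<not> ?thesis"
  then have "(INF i\<in>I. f i) + (INF j\<in>J. g j) < c" by simp
  then obtain z where z: "(INF i\<in>I. f i) + (INF j\<in>J. g j) < z" "z < c"
    using dense by blast
  then have "z < top" using order_less_le_trans top_greatest by blast
  then obtain r where r: "0 \<le> r" "z = ennreal r" by (cases z) auto
  have "(INF i\<in>I. f i) < top" "(INF j\<in>J. g j) < top"
    using order.strict_trans[OF z(1) \<open>z < top\<close>] unfolding ennreal_add_less_top by blast+
  then obtain x y where x: "0 \<le> x" "(INF i\<in>I. f i) = ennreal x"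
    and y: "0 \<le> y" "(INF j\<in>J. g j) = ennreal y"
    by (cases "INF i\<in>I. f i"; cases "INF j\<in>J. g j") auto
  define e where "e = (r - x - y) / 2"
  have "x + y < r" using z(1) r x y by (simp add: ennreal_less_iff flip: ennreal_plus)
  then have e: "0 < e" by (simp add: e_def)
  have "(INF i\<in>I. f i) < ennreal (x + e)" "(INF j\<in>J. g j) < ennreal (y + e)"
    using x y e by (simp_all add: ennreal_less_iff)
  then obtain i j where ij: "i \<in> I" "f i < ennreal (x + e)" "j \<in> J" "g j < ennreal (y + e)"
    by (auto simp: INF_less_iff)
  have "c \<le> ennreal (x + e) + ennreal (y + e)"
    using le[OF ij(1,3)] ij(2,4) by (meson add_mono less_imp_le order_trans)
  also have "\<dots> = z" using x y e r by (simp add: e_def field_simps flip: ennreal_plus)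
  finally show False using z(2) by simp
qed

lemma suminf_interleave_le:
  fixes f g :: "nat \<Rightarrow> ennreal"
  shows "(\<Sum>n. if even n then f (n div 2) else g (n div 2)) \<le> suminf f + suminf g"
proof (rule suminf_le_const)
  fix n
  let ?h = "\<lambda>n. if even n then f (n div 2) else g (n div 2)"
  have "sum ?h {..<n} \<le> sum ?h {..<2 * n}"
    by (intro sum_mono2) auto
  also have "sum ?h {..<2 * n} = sum f {..<n} + sum g {..<n}"
    by (induction n) (auto simp: ac_simps)
  also have "\<dots> \<le> suminf f + suminf g"
    by (intro add_mono sum_le_suminf) auto
  finally show "sum ?h {..<n} \<le> suminf f + suminf g" .
qed auto

text \<open>
  Interleaving a cover of \<open>A\<close> with a cover of \<open>B\<close> covers the union.
\<close>

lemma hausdorff_measure_1_Un_le: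
  "hausdorff_measure_1 (A \<union> B) \<le> hausdorff_measure_1 A + hausdorff_measure_1 B"
proof (rule hausdorff_measure_1_leI)
  fix d :: real assume d: "d > 0"
  have "hausdorff_premeasure_1 d (A \<union> B)
      \<le> (\<Sum>n. ennreal (diameter (U n))) + (\<Sum>n. ennreal (diameter (V n)))"
    if U: "A \<subseteq> (\<Union>n. U n)" "\<And>n. bounded (U n)" "\<And>n. diameter (U n) \<le> d"
      and V: "B \<subseteq> (\<Union>n. V n)" "\<And>n. bounded (V n)" "\<And>n. diameter (V n) \<le> d"
    for U V :: "nat \<Rightarrow> 'a set"
  proof -
    define W where "W = (\<lambda>n. if even n then U (n div 2) else V (n div 2))"
    have UW: "(\<Union>n. U n) \<subseteq> (\<Union>n. W n)"
    proof safe
      fix x n assume "x \<in> U n"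
      then have "x \<in> W (2 * n)" by (simp add: W_def)
      then show "x \<in> (\<Union>n. W n)" by blast
    qed
    have VW: "(\<Union>n. V n) \<subseteq> (\<Union>n. W n)"
    proof safe
      fix x n assume "x \<in> V n"
      then have "x \<in> W (2 * n + 1)" by (simp add: W_def)
      then show "x \<in> (\<Union>n. W n)" by blast
    qed
    have "A \<union> B \<subseteq> (\<Union>n. W n)"
      by (rule Un_least[OF order_trans[OF U(1) UW] order_trans[OF V(1) VW]])
    moreover have "bounded (W n)" "diameter (W n) \<le> d" for n
      using U(2,3) V(2,3) by (auto simp: W_def)
    ultimately have "hausdorff_premeasure_1 d (A \<union> B) \<le> (\<Sum>n. ennreal (diameter (W n)))"
      by (rule hausdorff_premeasure_1_le)
    also have "(\<lambda>n. ennreal (diameter (W n))) =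
        (\<lambda>n. if even n then (\<lambda>n. ennreal (diameter (U n))) (n div 2)
             else (\<lambda>n. ennreal (diameter (V n))) (n div 2))"
      by (auto simp: W_def)
    also have "suminf \<dots> \<le> (\<Sum>n. ennreal (diameter (U n))) + (\<Sum>n. ennreal (diameter (V n)))"
      by (rule suminf_interleave_le)
    finally show ?thesis .
  qed
  then have "hausdorff_premeasure_1 d (A \<union> B)
      \<le> hausdorff_premeasure_1 d A + hausdorff_premeasure_1 d B"
    unfolding hausdorff_premeasure_1_def[of d A] hausdorff_premeasure_1_def[of d B]
    by - (rule ennreal_le_INF_add_INF, simp)
  also have "\<dots> \<le> hausdorff_measure_1 A + hausdorff_measure_1 B"
    using d by (intro add_mono hausdorff_premeasure_1_le_measure)
  finally show "hausdorff_premeasure_1 d (A \<union> B) \<le> hausdorff_measure_1 A + hausdorff_measure_1 B" .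
qed

text \<open>
  A non-expanding map does not increase the diameters of the sets of a cover. Only the parts
  of the covering sets inside \<open>A\<close> are mapped, since nothing is known about \<open>f\<close> elsewhere.
\<close>

lemma hausdorff_measure_1_lipschitz_image_le:
  fixes f :: "'a::metric_space \<Rightarrow> 'b::metric_space"
  assumes f: "\<And>x y. x \<in> A \<Longrightarrow> y \<in> A \<Longrightarrow> dist (f x) (f y) \<le> dist x y"
  shows "hausdorff_measure_1 (f ` A) \<le> hausdorff_measure_1 A"
proof (rule hausdorff_measure_1_leI)
  fix d :: real assume d: "d > 0"
  have "hausdorff_premeasure_1 d (f ` A) \<le> hausdorff_premeasure_1 d A"
  proof (rule hausdorff_premeasure_1_geI)
    fix U :: "nat \<Rightarrow> 'a set"
    assume U: "A \<subseteq> (\<Union>n. U n)" "\<And>n. bounded (U n)" "\<And>n. diameter (U n) \<le> d"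
    have dist: "dist (f x) (f y) \<le> diameter (U n)" if "x \<in> A \<inter> U n" "y \<in> A \<inter> U n" for x y n
      using f[of x y] diameter_bounded_bound[OF U(2), of x n y] that by auto
    have bd: "bounded (f ` (A \<inter> U n))" for n
      using dist by (auto simp: bounded_two_points)
    have diam: "diameter (f ` (A \<inter> U n)) \<le> diameter (U n)" for n
      unfolding diameter_def[of "f ` (A \<inter> U n)"]
      using dist diameter_ge_0[OF U(2), of n] by (auto intro!: cSUP_least)
    have "hausdorff_premeasure_1 d (f ` A) \<le> (\<Sum>n. ennreal (diameter (f ` (A \<inter> U n))))"
    proof (rule hausdorff_premeasure_1_le)
      show "f ` A \<subseteq> (\<Union>n. f ` (A \<inter> U n))" using U(1) by blast
      show "diameter (f ` (A \<inter> U n)) \<le> d" for n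
        using diam[of n] U(3)[of n] by linarith
    qed (rule bd)
    also have "\<dots> \<le> (\<Sum>n. ennreal (diameter (U n)))"
      using diam by (intro suminf_le) (auto intro: ennreal_leI)
    finally show "hausdorff_premeasure_1 d (f ` A) \<le> (\<Sum>n. ennreal (diameter (U n)))" .
  qed
  then show "hausdorff_premeasure_1 d (f ` A) \<le> hausdorff_measure_1 A"
    using hausdorff_premeasure_1_le_measure[OF d] order_trans by blast
qed

lemma hausdorff_measure_1_interval_le:
  fixes l :: real
  assumes "0 \<le> l"
  shows "hausdorff_measure_1 {0..l} \<le> ennreal l"
proof (rule hausdorff_measure_1_leI)
  fix d :: real assume d: "d > 0"
  obtain N :: nat where N: "N > l / d" using reals_Archimedean2 by blast
  have N0: "N > 0" using N assms d by (metis divide_nonneg_pos gr0I not_le of_nat_0)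
  have ld: "l / N \<le> d" using N N0 d by (simp add: field_simps)
  \<comment> \<open>\<open>N\<close> equal pieces, padded with empty sets to a sequence\<close>
  define U where "U = (\<lambda>n. if n < N then {n * (l / N) .. Suc n * (l / N)} else {})"
  have le: "real n * (l / N) \<le> Suc n * (l / N)" for n
    using assms by (intro mult_right_mono) auto
  have diam: "diameter (U n) = (if n < N then l / N else 0)" for n
    using le[of n] by (simp add: U_def diameter_closed_interval algebra_simps flip: add_divide_distrib)
  have cover: "{0..l} \<subseteq> (\<Union>n. U n)"
  proof
    fix x assume x: "x \<in> {0..l}"
    show "x \<in> (\<Union>n. U n)"
    proof (cases "x = l")
      case True
      then have "x \<in> U (N - 1)" using N0 assms by (auto simp: U_def field_simps)
      then show ?thesis by blast
    next
      case False
      then have l: "l > 0" "x < l" "0 \<le> x" using x by auto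
      define n where "n = nat \<lfloor>x / (l / N)\<rfloor>"
      have "0 \<le> x / (l / N)" using l by simp
      then have "real n \<le> x / (l / N)" "x / (l / N) < Suc n" unfolding n_def by linarith+
      then have n: "n * (l / N) \<le> x" "x \<le> Suc n * (l / N)" using l N0
        by (simp_all add: field_simps)
      have "real n * (l / N) < N * (l / N)" using n(1) l N0 by simp
      then have "n < N" using l N0 by (simp add: field_simps)
      with n have "x \<in> U n" by (simp add: U_def)
      then show ?thesis by blast
    qed
  qed
  have "hausdorff_premeasure_1 d {0..l} \<le> (\<Sum>n. ennreal (diameter (U n)))"
    using cover ld d by (intro hausdorff_premeasure_1_le) (simp_all add: diam, simp add: U_def)
  also have "\<dots> = (\<Sum>n<N. ennreal (diameter (U n)))"
    by (intro suminf_finite) (auto simp: diam)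
  also have "\<dots> = ennreal l"
    using assms N0 by (simp add: diam ennreal_of_nat_eq_real_of_nat flip: ennreal_mult)
  finally show "hausdorff_premeasure_1 d {0..l} \<le> ennreal l" .
qed

text \<open>
  A bounded set of reals lies in an interval as long as its diameter, so countable subadditivity of
  Lebesgue measure bounds the total diameter of every cover from below, already at scale 1.
\<close>

lemma hausdorff_measure_1_interval_ge:
  fixes l :: real
  assumes "0 \<le> l"
  shows "ennreal l \<le> hausdorff_measure_1 {0..l}"
proof -
  have "ennreal l \<le> hausdorff_premeasure_1 1 {0..l}"
  proof (rule hausdorff_premeasure_1_geI)
    fix U :: "nat \<Rightarrow> real set"
    assume U: "{0..l} \<subseteq> (\<Union>n. U n)" "\<And>n. bounded (U n)"
    define V where "V = (\<lambda>n. if U n = {} then {} else {Inf (U n)..Sup (U n)})"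
    have UV: "U n \<subseteq> V n" for n
      using bounded_imp_bdd_above[OF U(2)[of n]] bounded_imp_bdd_below[OF U(2)[of n]]
      by (auto simp: V_def intro: cInf_lower cSup_upper)
    have V: "emeasure lborel (V n) \<le> ennreal (diameter (U n))" for n
    proof (cases "U n = {}")
      case False
      have *: "x - y \<le> diameter (U n)" if "x \<in> U n" "y \<in> U n" for x y
        using diameter_bounded_bound[OF U(2) that] by (simp add: dist_real_def)
      have "Sup (U n) \<le> diameter (U n) + y" if "y \<in> U n" for y
        using False *[OF _ that] by (intro cSup_least) (auto simp: algebra_simps)
      then have "Sup (U n) - diameter (U n) \<le> Inf (U n)"
        using False by (intro cInf_greatest) (auto simp: algebra_simps)
      moreover have "Inf (U n) \<le> Sup (U n)"
        using False UV[of n] by (auto simp: V_def)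
      ultimately show ?thesis using False by (auto simp: V_def intro!: ennreal_leI)
    qed (simp add: V_def)
    have "ennreal l = emeasure lborel {0..l}" using assms by simp
    also have "\<dots> \<le> emeasure lborel (\<Union>n. V n)"
    proof (rule emeasure_mono)
      show "{0..l} \<subseteq> (\<Union>n. V n)" using U(1) UV by blast
    qed (auto simp: V_def)
    also have "\<dots> \<le> (\<Sum>n. emeasure lborel (V n))"
      by (intro emeasure_subadditive_countably) (auto simp: V_def)
    also have "\<dots> \<le> (\<Sum>n. ennreal (diameter (U n)))"
      by (intro suminf_le V) auto
    finally show "ennreal l \<le> (\<Sum>n. ennreal (diameter (U n)))" .
  qed
  then show ?thesis using hausdorff_premeasure_1_le_measure[of 1 "{0..l}"] by simp
qed

text \<open>
  A set of diameter less than \<open>\<delta>\<close> cannot meet both parts, so a fine cover of the union splits into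
  a cover of \<open>A\<close> and a cover of \<open>B\<close>. With subadditivity, this additivity on separated sets
  is all that is needed to measure the boundary of a triangle.
\<close>

lemma hausdorff_measure_1_separated:
  fixes A B :: "'a::metric_space set"
  assumes \<delta>: "\<delta> > 0" "\<And>x y. x \<in> A \<Longrightarrow> y \<in> B \<Longrightarrow> \<delta> \<le> dist x y"
  shows "hausdorff_measure_1 A + hausdorff_measure_1 B \<le> hausdorff_measure_1 (A \<union> B)"
proof -
  have pre: "hausdorff_premeasure_1 d A + hausdorff_premeasure_1 d B \<le> hausdorff_premeasure_1 d (A \<union> B)"
    if d: "0 < d" "d < \<delta>" for d
  proof (rule hausdorff_premeasure_1_geI)
    fix U :: "nat \<Rightarrow> 'a set"
    assume U: "A \<union> B \<subseteq> (\<Union>n. U n)" "\<And>n. bounded (U n)" "\<And>n. diameter (U n) \<le> d"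
    define V where "V = (\<lambda>n. if U n \<inter> A = {} then {} else U n)"
    define W where "W = (\<lambda>n. if U n \<inter> A = {} then U n else {})"
    have W: "B \<subseteq> (\<Union>n. W n)"
    proof
      fix x assume x: "x \<in> B"
      then obtain n where n: "x \<in> U n" using U by blast
      have "U n \<inter> A = {}"
      proof (rule ccontr)
        \<comment> \<open>a covering set that meets both parts would have diameter at least \<open>\<delta>\<close>\<close>
        assume "U n \<inter> A \<noteq> {}"
        then obtain y where y: "y \<in> U n" "y \<in> A" by blast
        show False
          using diameter_bounded_bound[OF U(2) y(1) n] U(3)[of n] \<delta>(2)[OF y(2) x] d by simp
      qed
      with n have "x \<in> W n" by (simp add: W_def)
      then show "x \<in> (\<Union>n. W n)" by blast
    qed
    have V: "A \<subseteq> (\<Union>n. V n)" using U(1) by (fastforce simp: V_def)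
    have "hausdorff_premeasure_1 d A + hausdorff_premeasure_1 d B
        \<le> (\<Sum>n. ennreal (diameter (V n))) + (\<Sum>n. ennreal (diameter (W n)))"
      using U V W d by (intro add_mono hausdorff_premeasure_1_le) (auto simp: V_def W_def)
    also have "\<dots> = (\<Sum>n. ennreal (diameter (V n)) + ennreal (diameter (W n)))"
      by (intro suminf_add) auto
    also have "\<dots> = (\<Sum>n. ennreal (diameter (U n)))"
      by (intro suminf_cong) (auto simp: V_def W_def)
    finally show "hausdorff_premeasure_1 d A + hausdorff_premeasure_1 d B
        \<le> (\<Sum>n. ennreal (diameter (U n)))" .
  qed
  have "hausdorff_measure_1 A + hausdorff_measure_1 B =
      (SUP d\<in>{0<..}. hausdorff_premeasure_1 d A + hausdorff_premeasure_1 d B)"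
    unfolding hausdorff_measure_1_def
  proof (rule SUP_add_directed_ennreal[symmetric])
    fix i j :: real assume "i \<in> {0<..}" "j \<in> {0<..}"
    then show "\<exists>k\<in>{0<..}. hausdorff_premeasure_1 i A + hausdorff_premeasure_1 j B
        \<le> hausdorff_premeasure_1 k A + hausdorff_premeasure_1 k B"
      by (intro bexI[of _ "min i j"] add_mono hausdorff_premeasure_1_antimono) auto
  qed
  also have "\<dots> \<le> hausdorff_measure_1 (A \<union> B)"
  proof (rule SUP_least)
    fix i :: real assume i: "i \<in> {0<..}"
    define k where "k = min i (\<delta> / 2)"
    have k: "0 < k" "k < \<delta>" "k \<le> i" using i \<delta>(1) by (auto simp: k_def)
    have "hausdorff_premeasure_1 i A + hausdorff_premeasure_1 i B
        \<le> hausdorff_premeasure_1 k A + hausdorff_premeasure_1 k B"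
      using k by (intro add_mono hausdorff_premeasure_1_antimono)
    also have "\<dots> \<le> hausdorff_premeasure_1 k (A \<union> B)" using pre k by blast
    also have "\<dots> \<le> hausdorff_measure_1 (A \<union> B)"
      using k by (intro hausdorff_premeasure_1_le_measure)
    finally show "hausdorff_premeasure_1 i A + hausdorff_premeasure_1 i B
        \<le> hausdorff_measure_1 (A \<union> B)" .
  qed
  finally show ?thesis .
qed

lemma hausdorff_measure_1_line_image_le:
  fixes p v :: "'a::real_normed_vector"
  assumes "norm v \<le> 1" "0 \<le> l"
  shows "hausdorff_measure_1 ((\<lambda>\<tau>. p + \<tau> *\<^sub>R v) ` {0..l}) \<le> ennreal l"
proof -
  have "hausdorff_measure_1 ((\<lambda>\<tau>. p + \<tau> *\<^sub>R v) ` {0..l}) \<le> hausdorff_measure_1 {0..l}"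
  proof (rule hausdorff_measure_1_lipschitz_image_le)
    fix x y :: real
    have "dist (p + x *\<^sub>R v) (p + y *\<^sub>R v) = \<bar>x - y\<bar> * norm v"
      by (simp add: dist_norm flip: scaleR_diff_left)
    also have "\<dots> \<le> \<bar>x - y\<bar> * 1" using assms by (intro mult_left_mono) auto
    finally show "dist (p + x *\<^sub>R v) (p + y *\<^sub>R v) \<le> dist x y" by (simp add: dist_real_def)
  qed
  also have "\<dots> \<le> ennreal l" using assms by (intro hausdorff_measure_1_interval_le)
  finally show ?thesis .
qed

text \<open>
  A segment is an isometric image of an interval, and orthogonal projection onto its line, which
  does not expand distances, maps it back onto that interval.
\<close>

lemma hausdorff_measure_1_closed_segment:
  fixes p q :: "'a::real_inner"
  shows "hausdorff_measure_1 (closed_segment p q) = ennreal (dist p q)"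
proof (cases "p = q")
  case True
  have "hausdorff_measure_1 ((\<lambda>\<tau>. p + \<tau> *\<^sub>R (0::'a)) ` {0..0}) \<le> ennreal 0"
    by (rule hausdorff_measure_1_line_image_le) auto
  then show ?thesis using True by simp
next
  case False
  define l where "l = dist p q"
  define v where "v = (q - p) /\<^sub>R l"
  have l: "l > 0" using False by (simp add: l_def)
  have v: "norm v = 1" using l by (simp add: v_def l_def dist_norm norm_minus_commute)
  have seg: "closed_segment p q = (\<lambda>\<tau>. p + \<tau> *\<^sub>R v) ` {0..l}"
  proof -
    have "closed_segment p q = (\<lambda>u. p + u *\<^sub>R (q - p)) ` {0..1}"
      unfolding closed_segment_def by (intro set_eqI) (force simp: algebra_simps)
    also have "\<dots> = (\<lambda>u. p + u *\<^sub>R v) ` (\<lambda>u. l * u) ` {0..1}"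
      unfolding image_image using l by (intro image_cong) (auto simp: v_def)
    also have "(\<lambda>u. l * u) ` {0..1} = {0..l}"
      using l by (simp add: image_mult_atLeastAtMost)
    finally show ?thesis .
  qed
  have "ennreal l \<le> hausdorff_measure_1 {0..l}"
    using l by (intro hausdorff_measure_1_interval_ge) auto
  also have "{0..l} = (\<lambda>z. (z - p) \<bullet> v) ` closed_segment p q"
    using v by (simp add: seg image_image norm_eq_1)
  also have "hausdorff_measure_1 \<dots> \<le> hausdorff_measure_1 (closed_segment p q)"
  proof (rule hausdorff_measure_1_lipschitz_image_le)
    fix x y
    have "dist ((x - p) \<bullet> v) ((y - p) \<bullet> v) = \<bar>(x - y) \<bullet> v\<bar>"
      by (simp add: dist_real_def algebra_simps)
    also have "\<dots> \<le> dist x y" using Cauchy_Schwarz_ineq2[of "x - y" v] v by (simp add: dist_norm)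
    finally show "dist ((x - p) \<bullet> v) ((y - p) \<bullet> v) \<le> dist x y" .
  qed
  finally show ?thesis
    using hausdorff_measure_1_line_image_le[of v l p] v l unfolding seg l_def by (intro antisym) auto
qed



text \<open>
  Twice the signed area of the triangle \<open>pqr\<close>.
\<close>

definition orient :: "real^2 \<Rightarrow> real^2 \<Rightarrow> real^2 \<Rightarrow> real" where
  "orient p q r = (q$1 - p$1) * (r$2 - p$2) - (q$2 - p$2) * (r$1 - p$1)"

lemma orient_cyclic: "orient q r p = orient p q r"
  by (simp add: orient_def algebra_simps)

lemma orient_swap: "orient p r q = - orient p q r"
  by (simp add: orient_def algebra_simps)

lemma orient_degenerate [simp]: "orient p p q = 0" "orient p q p = 0" "orient p q q = 0"
  by (simp_all add: orient_def)

lemma orient_affine: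
  assumes "u + v = 1"
  shows "orient (u *\<^sub>R x + v *\<^sub>R y) p q = u * orient x p q + v * orient y p q"
proof -
  have v: "v = 1 - u" using assms by simp
  show ?thesis unfolding v by (simp add: orient_def) algebra
qed

lemma continuous_on_orient [continuous_intros]:
  assumes "continuous_on S f" "continuous_on S g" "continuous_on S h"
  shows "continuous_on S (\<lambda>x. orient (f x) (g x) (h x))"
  unfolding orient_def by (intro continuous_intros assms)

lemma area_triangle_eq_content:
  "area (convex hull {p, q, r}) = measure lborel (convex hull {p, q, r})"
  unfolding area_def by (simp add: borel_compact finite_imp_compact_convex_hull)

lemma area_triangle: "area (convex hull {p, q, r}) = \<bar>orient p q r\<bar> / 2"
  by (simp add: area_triangle_eq_content content_triangle orient_def abs_minus_commute mult.commute)

section \<open>Barycentric coordinates in the plane\<close>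

text \<open>
  The barycentric coordinate of \<open>z\<close> belonging to the first vertex \<open>a\<close>, as a quotient of areas. The
  coordinates of \<open>b\<close> and \<open>c\<close> are \<open>bary b c a\<close> and \<open>bary c a b\<close>, so that each fact is
  proved for one coordinate and transferred to the others by rotating the vertices.
\<close>

definition bary :: "real^2 \<Rightarrow> real^2 \<Rightarrow> real^2 \<Rightarrow> real^2 \<Rightarrow> real" where
  "bary a b c z = orient z b c / orient a b c"

lemma bary_vertex:
  assumes "orient a b c \<noteq> 0"
  shows "bary a b c a = 1" "bary a b c b = 0" "bary a b c c = 0"
  using assms by (simp_all add: bary_def)

lemma bary_sum:
  assumes "orient a b c \<noteq> 0"
  shows "bary a b c z + bary b c a z + bary c a b z = 1"
proof -
  have "orient z b c + orient z c a + orient z a b = orient a b c"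
    by (simp add: orient_def algebra_simps)
  then show ?thesis
    using assms by (simp add: bary_def orient_cyclic[of c a b] orient_cyclic[of b c a] flip: add_divide_distrib)
qed

lemma bary_expand:
  assumes "orient a b c \<noteq> 0"
  shows "z = bary a b c z *\<^sub>R a + bary b c a z *\<^sub>R b + bary c a b z *\<^sub>R c"
proof -
  have "orient a b c * z$i = orient z b c * a$i + orient z c a * b$i + orient z a b * c$i" for i
    using exhaust_2[of i] by (auto simp: orient_def algebra_simps)
  then show ?thesis
    using assms
    by (simp add: vec_eq_iff bary_def orient_cyclic[of c a b] orient_cyclic[of b c a] field_simps)
qed

lemma bary_affine:
  assumes "u + v = 1"
  shows "bary a b c (u *\<^sub>R x + v *\<^sub>R y) = u * bary a b c x + v * bary a b c y"
  using orient_affine[OF assms] by (simp add: bary_def add_divide_distrib)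

lemma continuous_on_bary [continuous_intros]:
  "orient a b c \<noteq> 0 \<Longrightarrow> continuous_on S (bary a b c)"
  unfolding bary_def by (intro continuous_intros) auto

text \<open>
  In barycentric coordinates the area of a triangle is the determinant of the three coordinate rows;
  with \<open>c\<close> as one of the vertices it collapses to a two by two minor.
\<close>

lemma orient_eq_bary:
  assumes "orient a b c \<noteq> 0"
  shows "orient p q c = orient a b c * (bary a b c p * bary b c a q - bary b c a p * bary a b c q)"
proof -
  have "orient a b c * orient p q c = orient p b c * orient q c a - orient p c a * orient q b c"
    unfolding orient_def by algebra
  then have "orient p q c = (orient p b c * orient q c a - orient p c a * orient q b c) / orient a b c"
    using assms by (simp add: eq_divide_eq mult.commute)
  also have "\<dots> = orient a b c *
      (bary a b c p * bary b c a q - bary b c a p * bary a b c q)"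
    using assms
    by (simp add: bary_def orient_cyclic[of b c a] orient_cyclic[of c a b] diff_divide_distrib right_diff_distrib)
  finally show ?thesis .
qed

lemma convex_bary_ge_0: "convex {z. 0 \<le> bary a b c z}"
  by (intro convexI) (simp add: bary_affine)

lemma convex_bary_le_0: "convex {z. bary a b c z \<le> 0}"
  by (intro convexI) (simp add: bary_affine add_nonpos_nonpos mult_nonneg_nonpos)

lemma negligible_bary_eq_0:
  assumes "orient a b c \<noteq> 0"
  shows "negligible {z. bary a b c z = 0}"
proof -
  let ?n = "vector [b$2 - c$2, c$1 - b$1] :: real^2"
  have "?n \<noteq> 0"
  proof
    assume "?n = 0"
    then have "?n$1 = 0" "?n$2 = 0" by simp_all
    then have "b$2 = c$2" "b$1 = c$1" by simp_all
    then show False using assms by (simp add: orient_def)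
  qed
  then have "negligible {z. ?n \<bullet> z = c$1 * b$2 - b$1 * c$2}"
    by (intro negligible_hyperplane) auto
  also have "{z. ?n \<bullet> z = c$1 * b$2 - b$1 * c$2} = {z. bary a b c z = 0}"
    using assms by (auto simp: bary_def orient_def inner_vec_def sum_2 algebra_simps)
  finally show ?thesis .
qed

section \<open>Area and perimeter of planar convex sets\<close>

text \<open>
  Beyond each side of the triangle a further triangle is erected on that side, with its apex in \<open>K\<close>.
  The signs of the barycentric coordinates keep the four triangles apart: any two of them meet
  inside a line through two of the vertices.
\<close>

lemma area_ge_triangle_with_caps:
  assumes K: "convex K" "compact K" and D: "orient a b c > 0"
    and in_K: "{a, b, c, p1, p2, p3} \<subseteq> K"
    and p1: "bary a b c p1 \<le> 0" "0 \<le> bary b c a p1" "0 \<le> bary c a b p1"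
    and p2: "0 \<le> bary a b c p2" "bary b c a p2 \<le> 0" "0 \<le> bary c a b p2"
    and p3: "0 \<le> bary a b c p3" "0 \<le> bary b c a p3" "bary c a b p3 \<le> 0"
  shows "orient a b c / 2 * (1 - bary a b c p1 - bary b c a p2 - bary c a b p3) \<le> area K"
proof -
  define S where "S = (\<lambda>i::nat. convex hull
    (if i = 0 then {a, b, c} else if i = 1 then {p1, b, c} else if i = 2 then {p2, c, a} else {p3, a, b}))"
  have D0: "orient a b c \<noteq> 0" "orient b c a \<noteq> 0" "orient c a b \<noteq> 0"
    using D by (simp_all add: orient_cyclic[of b c a] orient_cyclic[of c a b])
  have vert: "bary a b c a = 1" "bary a b c b = 0" "bary a b c c = 0"
     "bary b c a b = 1" "bary b c a c = 0" "bary b c a a = 0"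
     "bary c a b c = 1" "bary c a b a = 0" "bary c a b b = 0"
    using bary_vertex D0 by auto
  have SK: "S i \<subseteq> K" for i
    unfolding S_def using K in_K by (intro hull_minimal) auto
  have S0: "S 0 \<subseteq> {z. 0 \<le> bary a b c z} \<inter> {z. 0 \<le> bary b c a z} \<inter> {z. 0 \<le> bary c a b z}"
    unfolding S_def by (intro hull_minimal convex_Int convex_bary_ge_0) (auto simp: vert)
  have S1: "S 1 \<subseteq> {z. bary a b c z \<le> 0} \<inter> {z. 0 \<le> bary b c a z} \<inter> {z. 0 \<le> bary c a b z}"
    unfolding S_def using p1
    by (intro hull_minimal convex_Int convex_bary_ge_0 convex_bary_le_0) (auto simp: vert)
  have S2: "S 2 \<subseteq> {z. 0 \<le> bary a b c z} \<inter> {z. bary b c a z \<le> 0} \<inter> {z. 0 \<le> bary c a b z}"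
    unfolding S_def using p2
    by (intro hull_minimal convex_Int convex_bary_ge_0 convex_bary_le_0) (auto simp: vert)
  have S3: "S 3 \<subseteq> {z. 0 \<le> bary a b c z} \<inter> {z. 0 \<le> bary b c a z} \<inter> {z. bary c a b z \<le> 0}"
    unfolding S_def using p3
    by (intro hull_minimal convex_Int convex_bary_ge_0 convex_bary_le_0) (auto simp: vert)
  have lm: "S i \<in> lmeasurable" for i
    unfolding S_def by (intro lmeasurable_compact finite_imp_compact_convex_hull) auto
  have neg: "negligible {z. bary a b c z = 0}" "negligible {z. bary b c a z = 0}"
      "negligible {z. bary c a b z = 0}"
    using negligible_bary_eq_0 D0 by auto
  have I01: "S 0 \<inter> S 1 \<subseteq> {z. bary a b c z = 0}" using S0 S1 by fastforce
  have I02: "S 0 \<inter> S 2 \<subseteq> {z. bary b c a z = 0}" using S0 S2 by fastforce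
  have I03: "S 0 \<inter> S 3 \<subseteq> {z. bary c a b z = 0}" using S0 S3 by fastforce
  have I12: "S 1 \<inter> S 2 \<subseteq> {z. bary a b c z = 0}" using S1 S2 by fastforce
  have I13: "S 1 \<inter> S 3 \<subseteq> {z. bary a b c z = 0}" using S1 S3 by fastforce
  have I23: "S 2 \<inter> S 3 \<subseteq> {z. bary b c a z = 0}" using S2 S3 by fastforce
  have N: "negligible (S 0 \<inter> S 1)" "negligible (S 0 \<inter> S 2)" "negligible (S 0 \<inter> S 3)"
    "negligible (S 1 \<inter> S 2)" "negligible (S 1 \<inter> S 3)" "negligible (S 2 \<inter> S 3)"
    using I01 I02 I03 I12 I13 I23 neg by (blast intro: negligible_subset)+
  have pw: "pairwise (\<lambda>i j. negligible (S i \<inter> S j)) {0, 1, 2, 3}"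
    using N by (auto simp: pairwise_insert Int_commute)
  have "measure lebesgue (\<Union>(S ` {0, 1, 2, 3})) = (\<Sum>i\<in>{0, 1, 2, 3}. measure lebesgue (S i))"
    by (intro measure_negligible_finite_Union_image lm pw) auto
  also have "\<dots> = area (convex hull {a, b, c}) + area (convex hull {p1, b, c})
      + area (convex hull {p2, c, a}) + area (convex hull {p3, a, b})"
    by (simp add: S_def area_def)
  also have "\<dots> = orient a b c / 2 * (1 - bary a b c p1 - bary b c a p2 - bary c a b p3)"
  proof -
    have "orient p1 b c = orient a b c * bary a b c p1" "orient p2 c a = orient a b c * bary b c a p2"
      "orient p3 a b = orient a b c * bary c a b p3"
      using D0 by (simp_all add: bary_def orient_cyclic[of b c a] orient_cyclic[of c a b])
    then have "\<bar>orient p1 b c\<bar> = - (orient a b c * bary a b c p1)"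
      "\<bar>orient p2 c a\<bar> = - (orient a b c * bary b c a p2)"
      "\<bar>orient p3 a b\<bar> = - (orient a b c * bary c a b p3)"
      using p1(1) p2(2) p3(3) D by (simp_all add: abs_mult)
    then show ?thesis using D by (simp add: area_triangle algebra_simps)
  qed
  finally have "measure lebesgue (\<Union>(S ` {0, 1, 2, 3})) =
    orient a b c / 2 * (1 - bary a b c p1 - bary b c a p2 - bary c a b p3)" .
  moreover have "measure lebesgue (\<Union>(S ` {0, 1, 2, 3})) \<le> measure lebesgue K"
    using SK K lm by (intro measure_mono_fmeasurable lmeasurable_compact) auto
  ultimately show ?thesis by (simp add: area_def)
qed

text \<open>
  This makes perimeter monotone on convex sets. The nearest point map of \<open>K\<close> does not expand distances, and it maps the
  boundary of \<open>P\<close> onto a set containing the boundary of \<open>K\<close>: from a boundary point \<open>x\<close>, walk along an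
  outer normal of \<open>K\<close> until \<open>P\<close> is left; the nearest point of \<open>K\<close> is \<open>x\<close> all the way.
\<close>

lemma hausdorff_measure_1_frontier_convex_le:
  fixes K P :: "'a::euclidean_space set"
  assumes K: "convex K" "compact K" "interior K \<noteq> {}" and P: "K \<subseteq> P" "bounded P"
  shows "hausdorff_measure_1 (frontier K) \<le> hausdorff_measure_1 (frontier P)"
proof -
  have "closed K" "K \<noteq> {}" using K compact_imp_closed by auto
  have "frontier K \<subseteq> closest_point K ` frontier P"
  proof
    fix x assume x: "x \<in> frontier K"
    then have xK: "x \<in> K" "x \<notin> interior K"
      using \<open>closed K\<close> by (auto simp: frontier_def)
    have ri: "rel_interior K = interior K" using K(3) by (rule rel_interior_nonempty_interior)
    obtain a where a: "a \<noteq> 0" "\<And>y. y \<in> K \<Longrightarrow> a \<bullet> x \<le> a \<bullet> y"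
      using supporting_hyperplane_relative_frontier[of K x] K(1) xK \<open>closed K\<close> ri
      by (metis closure_closed)
    \<comment> \<open>\<open>a\<close> is an inner normal, so this is the ray that leaves \<open>K\<close> at \<open>x\<close>\<close>
    define R where "R = (\<lambda>\<tau>. x - \<tau> *\<^sub>R a) ` {0..}"
    have "connected R"
      unfolding R_def by (intro connected_continuous_image continuous_intros) auto
    moreover have "R \<inter> P \<noteq> {}"
    proof -
      have "x \<in> R" unfolding R_def by (rule image_eqI[of _ _ 0]) auto
      then show ?thesis using xK P by blast
    qed
    moreover have "R - P \<noteq> {}"
    proof -
      obtain B where B: "\<And>y. y \<in> P \<Longrightarrow> norm y \<le> B" using P(2) bounded_iff by blast
      have B0: "norm x \<le> B" using B xK P by blast
      \<comment> \<open>so far out that the point of the ray has norm greater than \<open>B\<close>\<close>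
      define \<tau> where "\<tau> = (2 * B + 1) / norm a"
      have B1: "0 \<le> B" using B0 norm_ge_zero order_trans by blast
      have "\<tau> \<ge> 0" using B1 by (simp add: \<tau>_def)
      have "norm (\<tau> *\<^sub>R a) = 2 * B + 1" using a B1 by (simp add: \<tau>_def)
      then have "norm (x - \<tau> *\<^sub>R a) > B"
        using norm_triangle_ineq3[of x "\<tau> *\<^sub>R a"] B0 B1 by linarith
      then have "x - \<tau> *\<^sub>R a \<notin> P" using B by force
      moreover have "x - \<tau> *\<^sub>R a \<in> R" unfolding R_def using \<open>\<tau> \<ge> 0\<close> by auto
      ultimately show ?thesis by blast
    qed
    ultimately have "R \<inter> frontier P \<noteq> {}" by (rule connected_Int_frontier)
    then obtain \<tau> where \<tau>: "\<tau> \<ge> 0" "x - \<tau> *\<^sub>R a \<in> frontier P" by (auto simp: R_def)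
    have "x = closest_point K (x - \<tau> *\<^sub>R a)"
    proof (rule closest_point_unique[OF K(1) \<open>closed K\<close> xK(1)], intro ballI)
      fix y assume y: "y \<in> K"
      have "0 \<le> \<tau> * (a \<bullet> (y - x))" using a(2)[OF y] \<tau> by (simp add: inner_diff_right)
      then have "(norm (\<tau> *\<^sub>R a))\<^sup>2 \<le> (norm (\<tau> *\<^sub>R a + (y - x)))\<^sup>2"
        unfolding power2_norm_eq_inner by (simp add: inner_add_left inner_add_right inner_commute)
      then have "norm (\<tau> *\<^sub>R a) \<le> norm (\<tau> *\<^sub>R a + (y - x))"
        by (rule power2_le_imp_le) auto
      moreover have "dist (x - \<tau> *\<^sub>R a) y = norm (\<tau> *\<^sub>R a + (y - x))"
        by (metis dist_commute dist_norm diff_diff_eq2 add.commute add_diff_eq)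
      ultimately show "dist (x - \<tau> *\<^sub>R a) x \<le> dist (x - \<tau> *\<^sub>R a) y"
        by (simp add: dist_norm)
    qed
    then show "x \<in> closest_point K ` frontier P" using \<tau>(2) by blast
  qed
  then have "hausdorff_measure_1 (frontier K) \<le> hausdorff_measure_1 (closest_point K ` frontier P)"
    by (rule hausdorff_measure_1_mono)
  also have "\<dots> \<le> hausdorff_measure_1 (frontier P)"
    using closest_point_lipschitz[OF K(1) \<open>closed K\<close> \<open>K \<noteq> {}\<close>]
    by (intro hausdorff_measure_1_lipschitz_image_le)
  finally show ?thesis .
qed

text \<open>
  The bounds on the coordinates describe a hexagon around \<open>K\<close>: the line through the
  \<open>i\<close>-th side of the unit triangle is moved outwards by \<open>s\<^sub>i\<close> times the height, and the three resulting corners are cut off by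
  the lines through the vertices parallel to the opposite sides. The moved sides have lengths
  \<open>1 - s\<^sub>i\<close>, the cuts have lengths \<open>s\<^sub>i + s\<^sub>j\<close>, and the total is \<open>3 + s1 + s2 + s3\<close>.
\<close>

lemma perimeter_le_hexagon:
  assumes K: "convex_body K" and D: "orient a b c > 0"
    and unit: "dist a b = 1" "dist b c = 1" "dist c a = 1"
    and s: "s1 \<in> {0..1}" "s2 \<in> {0..1}" "s3 \<in> {0..1}"
    and in_hex: "\<And>z. z \<in> K \<Longrightarrow> bary a b c z \<in> {-s1..1}"
      "\<And>z. z \<in> K \<Longrightarrow> bary b c a z \<in> {-s2..1}" "\<And>z. z \<in> K \<Longrightarrow> bary c a b z \<in> {-s3..1}"
  shows "perimeter K \<le> 3 + s1 + s2 + s3"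
proof -
  define P where "P = {z. bary a b c z \<in> {-s1..1} \<and> bary b c a z \<in> {-s2..1} \<and> bary c a b z \<in> {-s3..1}}"
  define Q where "Q = {z. -s1 < bary a b c z} \<inter> {z. bary a b c z < 1} \<inter> {z. -s2 < bary b c a z} \<inter>
    {z. bary b c a z < 1} \<inter> {z. -s3 < bary c a b z} \<inter> {z. bary c a b z < 1}"
  have D0: "orient a b c \<noteq> 0" "orient b c a \<noteq> 0" "orient c a b \<noteq> 0"
    using D by (simp_all add: orient_cyclic[of b c a] orient_cyclic[of c a b])
  have "closed P"
  proof -
    have "P = {z. -s1 \<le> bary a b c z} \<inter> {z. bary a b c z \<le> 1} \<inter> {z. -s2 \<le> bary b c a z} \<inter>
      {z. bary b c a z \<le> 1} \<inter> {z. -s3 \<le> bary c a b z} \<inter> {z. bary c a b z \<le> 1}"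
      by (auto simp: P_def)
    then show ?thesis using D0 by (auto intro!: closed_Int closed_Collect_le continuous_intros)
  qed
  have "open Q"
    unfolding Q_def using D0 by (auto intro!: open_Int open_Collect_less continuous_intros)
  have "bounded P"
  proof (rule boundedI)
    fix z assume z: "z \<in> P"
    have "norm (bary a b c z *\<^sub>R a) \<le> norm a" "norm (bary b c a z *\<^sub>R b) \<le> norm b"
      "norm (bary c a b z *\<^sub>R c) \<le> norm c"
      using z s by (auto simp: P_def abs_le_iff intro!: mult_left_le_one_le)
    then have "norm (bary a b c z *\<^sub>R a + bary b c a z *\<^sub>R b + bary c a b z *\<^sub>R c)
        \<le> norm a + norm b + norm c"
      by (intro norm_triangle_mono)
    then show "norm z \<le> norm a + norm b + norm c"
      using bary_expand[OF D0(1), of z] by simp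
  qed
  \<comment> \<open>the moved sides, traversed at unit speed\<close>
  define E1 where "E1 = (\<lambda>\<tau>. (a + s3 *\<^sub>R (b - c)) + \<tau> *\<^sub>R (b - a)) ` {0..1 - s3}"
  define E2 where "E2 = (\<lambda>\<tau>. (b + s1 *\<^sub>R (c - a)) + \<tau> *\<^sub>R (c - b)) ` {0..1 - s1}"
  define E3 where "E3 = (\<lambda>\<tau>. (c + s2 *\<^sub>R (a - b)) + \<tau> *\<^sub>R (a - c)) ` {0..1 - s2}"
  \<comment> \<open>the cuts at the vertices \<open>a\<close>, \<open>b\<close>, \<open>c\<close>\<close>
  define F1 where "F1 = (\<lambda>\<tau>. (a - s2 *\<^sub>R (b - c)) + \<tau> *\<^sub>R (b - c)) ` {0..s2 + s3}"
  define F2 where "F2 = (\<lambda>\<tau>. (b - s3 *\<^sub>R (c - a)) + \<tau> *\<^sub>R (c - a)) ` {0..s3 + s1}"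
  define F3 where "F3 = (\<lambda>\<tau>. (c - s1 *\<^sub>R (a - b)) + \<tau> *\<^sub>R (a - b)) ` {0..s1 + s2}"
  have "frontier P \<subseteq> E1 \<union> (E2 \<union> (E3 \<union> (F1 \<union> (F2 \<union> F3))))"
  proof
    fix z assume z: "z \<in> frontier P"
    have "Q \<subseteq> P" by (auto simp: P_def Q_def)
    then have "Q \<subseteq> interior P" using \<open>open Q\<close> interior_maximal by blast
    then have zP: "z \<in> P" "z \<notin> Q" using z \<open>closed P\<close> by (auto simp: frontier_def)
    define x y w where xyw: "x = bary a b c z" "y = bary b c a z" "w = bary c a b z"
    have sum: "x + y + w = 1" using bary_sum[OF D0(1)] xyw by simp
    have z_eq: "z = x *\<^sub>R a + y *\<^sub>R b + w *\<^sub>R c" using bary_expand[OF D0(1)] xyw by simp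
    have bnd: "-s1 \<le> x" "x \<le> 1" "-s2 \<le> y" "y \<le> 1" "-s3 \<le> w" "w \<le> 1"
      using zP(1) by (auto simp: P_def xyw)
    have "x = -s1 \<or> x = 1 \<or> y = -s2 \<or> y = 1 \<or> w = -s3 \<or> w = 1"
      using zP bnd by (auto simp: Q_def simp flip: xyw)
    then consider "w = -s3" | "x = -s1" | "y = -s2" | "x = 1" | "y = 1" | "w = 1" by blast
    then show "z \<in> E1 \<union> (E2 \<union> (E3 \<union> (F1 \<union> (F2 \<union> F3))))"
    proof cases
      case 1
      then have y: "y = 1 + s3 - x" using sum by simp
      have "z = (a + s3 *\<^sub>R (b - c)) + (1 - x) *\<^sub>R (b - a)"
        unfolding z_eq y 1 by (simp add: algebra_simps)
      then have "z \<in> E1" unfolding E1_def using bnd 1 y by (intro image_eqI[of _ _ "1 - x"]) auto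
      then show ?thesis by blast
    next
      case 2
      then have y: "w = 1 + s1 - y" using sum by simp
      have "z = (b + s1 *\<^sub>R (c - a)) + (1 - y) *\<^sub>R (c - b)"
        unfolding z_eq y 2 by (simp add: algebra_simps)
      then have "z \<in> E2" unfolding E2_def using bnd 2 y by (intro image_eqI[of _ _ "1 - y"]) auto
      then show ?thesis by blast
    next
      case 3
      then have y: "x = 1 + s2 - w" using sum by simp
      have "z = (c + s2 *\<^sub>R (a - b)) + (1 - w) *\<^sub>R (a - c)"
        unfolding z_eq y 3 by (simp add: algebra_simps)
      then have "z \<in> E3" unfolding E3_def using bnd 3 y by (intro image_eqI[of _ _ "1 - w"]) auto
      then show ?thesis by blast
    next
      case 4
      then have y: "w = - y" using sum by simp
      have "z = (a - s2 *\<^sub>R (b - c)) + (y + s2) *\<^sub>R (b - c)"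
        unfolding z_eq y 4 by (simp add: algebra_simps)
      then have "z \<in> F1" unfolding F1_def using bnd 4 y by (intro image_eqI[of _ _ "y + s2"]) auto
      then show ?thesis by blast
    next
      case 5
      then have y: "x = - w" using sum by simp
      have "z = (b - s3 *\<^sub>R (c - a)) + (w + s3) *\<^sub>R (c - a)"
        unfolding z_eq y 5 by (simp add: algebra_simps)
      then have "z \<in> F2" unfolding F2_def using bnd 5 y by (intro image_eqI[of _ _ "w + s3"]) auto
      then show ?thesis by blast
    next
      case 6
      then have y: "y = - x" using sum by simp
      have "z = (c - s1 *\<^sub>R (a - b)) + (x + s1) *\<^sub>R (a - b)"
        unfolding z_eq y 6 by (simp add: algebra_simps)
      then have "z \<in> F3" unfolding F3_def using bnd 6 y by (intro image_eqI[of _ _ "x + s1"]) auto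
      then show ?thesis by blast
    qed
  qed
  then have "hausdorff_measure_1 (frontier P)
      \<le> hausdorff_measure_1 (E1 \<union> (E2 \<union> (E3 \<union> (F1 \<union> (F2 \<union> F3)))))"
    by (rule hausdorff_measure_1_mono)
  also have "\<dots> \<le> ennreal (1 - s3) + (ennreal (1 - s1) + (ennreal (1 - s2) +
      (ennreal (s2 + s3) + (ennreal (s3 + s1) + ennreal (s1 + s2)))))"
    unfolding E1_def E2_def E3_def F1_def F2_def F3_def
    using unit s
    by (intro order_trans[OF hausdorff_measure_1_Un_le] add_mono hausdorff_measure_1_line_image_le)
       (auto simp: dist_norm norm_minus_commute)
  also have "\<dots> = ennreal (3 + s1 + s2 + s3)"
    using s by (simp flip: ennreal_plus)
  finally have "hausdorff_measure_1 (frontier P) \<le> ennreal (3 + s1 + s2 + s3)" .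
  moreover have "K \<subseteq> P" using in_hex by (auto simp: P_def)
  ultimately have "hausdorff_measure_1 (frontier K) \<le> ennreal (3 + s1 + s2 + s3)"
    using hausdorff_measure_1_frontier_convex_le[of K P] K \<open>bounded P\<close>
    by (auto simp: convex_body_def intro: order_trans)
  then have "perimeter K \<le> enn2real (ennreal (3 + s1 + s2 + s3))"
    unfolding perimeter_def by (intro enn2real_mono) auto
  moreover have "enn2real (ennreal (3 + s1 + s2 + s3)) = 3 + s1 + s2 + s3"
    using s by (intro enn2real_ennreal) auto
  ultimately show ?thesis by simp
qed

text \<open>
  The sides meet at the vertices, so they are not separated. Each side is therefore shrunk
  towards its midpoint by a factor \<open>\<theta>\<close>: the shrunk sides are disjoint compact sets, on
  which length is additive, and \<open>\<theta>\<close> tends to 1.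
\<close>

lemma perimeter_triangle:
  assumes D: "orient a b c \<noteq> 0"
  shows "perimeter (convex hull {a, b, c}) = dist a b + dist b c + dist c a"
proof -
  let ?F = "closed_segment a b \<union> (closed_segment b c \<union> closed_segment c a)"
  let ?L = "dist a b + dist b c + dist c a"
  have D0: "orient b c a \<noteq> 0" "orient c a b \<noteq> 0"
    using D by (simp_all add: orient_cyclic[of b c a] orient_cyclic[of c a b])
  have fr: "frontier (convex hull {a, b, c}) = ?F"
    by (subst frontier_of_triangle) auto
  have "hausdorff_measure_1 ?F \<le> ennreal (dist a b) + (ennreal (dist b c) + ennreal (dist c a))"
    by (intro order_trans[OF hausdorff_measure_1_Un_le] add_mono)
       (auto simp: hausdorff_measure_1_closed_segment)
  then have le: "hausdorff_measure_1 ?F \<le> ennreal ?L"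
    by (simp add: add.assoc flip: ennreal_plus)
  define h where "h = enn2real (hausdorff_measure_1 ?F)"
  have h: "hausdorff_measure_1 ?F = ennreal h" "0 \<le> h"
    using le_less_trans[OF le ennreal_less_top] by (simp_all add: h_def)
  have "?L \<le> h"
  proof (rule field_le_mult_one_interval)
    fix \<theta> :: real assume \<theta>: "0 < \<theta>" "\<theta> < 1"
    define u v where uv: "u = (1 + \<theta>) / 2" "v = (1 - \<theta>) / 2"
    have uv1: "u > 0" "v > 0" "u + v = 1" "v + u = 1" "u - v = \<theta>" using \<theta> by (auto simp: uv field_simps)
    define seg where "seg = (\<lambda>p q :: real^2. closed_segment (u *\<^sub>R p + v *\<^sub>R q) (v *\<^sub>R p + u *\<^sub>R q))"
    have len: "hausdorff_measure_1 (seg p q) = ennreal (\<theta> * dist p q)" for p q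
    proof -
      have "(u *\<^sub>R p + v *\<^sub>R q) - (v *\<^sub>R p + u *\<^sub>R q) = (u - v) *\<^sub>R (p - q)"
        by (simp add: algebra_simps)
      then show ?thesis using \<theta> uv1
        by (simp add: seg_def hausdorff_measure_1_closed_segment dist_norm)
    qed
    have sub: "seg p q \<subseteq> closed_segment p q" for p q
    proof -
      have "u = 1 - v" "v = 1 - u" using uv1 by simp_all
      have "u *\<^sub>R p + v *\<^sub>R q \<in> closed_segment p q"
        unfolding closed_segment_def using uv1
        by (intro CollectI exI[of _ v]) (simp flip: \<open>u = 1 - v\<close>)
      moreover have "v *\<^sub>R p + u *\<^sub>R q \<in> closed_segment p q"
        unfolding closed_segment_def using uv1
        by (intro CollectI exI[of _ u]) (simp flip: \<open>v = 1 - u\<close>)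
      ultimately show ?thesis unfolding seg_def using subset_closed_segment by blast
    qed
    \<comment> \<open>the coordinate of a vertex vanishes on the opposite side and is positive on the two shrunk
      sides next to it, so the shrunk sides are disjoint\<close>
    have pos: "bary p q r z > 0" if "orient p q r \<noteq> 0" "z \<in> seg p q \<union> seg r p" for p q r z
    proof -
      have "convex {z. bary p q r z > 0}"
      proof (intro convexI)
        fix x y and k l :: real
        assume h: "x \<in> {z. bary p q r z > 0}" "y \<in> {z. bary p q r z > 0}" "0 \<le> k" "0 \<le> l" "k + l = 1"
        have "0 < k \<or> 0 < l" using h(3-5) by linarith
        then show "k *\<^sub>R x + l *\<^sub>R y \<in> {z. bary p q r z > 0}"
          using h by (auto simp: bary_affine intro: add_pos_nonneg add_nonneg_pos)
      qed
      moreover have "bary p q r (u *\<^sub>R p + v *\<^sub>R q) > 0" "bary p q r (v *\<^sub>R p + u *\<^sub>R q) > 0"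
        "bary p q r (u *\<^sub>R r + v *\<^sub>R p) > 0" "bary p q r (v *\<^sub>R r + u *\<^sub>R p) > 0"
        using uv1 that(1) by (simp_all add: bary_affine bary_vertex)
      ultimately show ?thesis
        using that(2) by (auto simp: seg_def dest: convex_contains_segment[THEN iffD1])
    qed
    have zero: "bary p q r z = 0" if "orient p q r \<noteq> 0" "z \<in> seg q r" for p q r z
    proof -
      from sub[of q r] that(2) obtain k where "z = (1 - k) *\<^sub>R q + k *\<^sub>R r"
        by (auto simp: closed_segment_def)
      then show ?thesis using bary_affine[of "1 - k" k p q r q r] that(1) by (simp add: bary_vertex)
    qed
    have comp: "compact (seg p q)" for p q unfolding seg_def by simp
    have "seg b c \<inter> seg c a = {}"
      using pos[OF D0(1)] zero[OF D0(1)] by fastforce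
    then obtain d where d: "d > 0" "\<And>x y. x \<in> seg b c \<Longrightarrow> y \<in> seg c a \<Longrightarrow> d \<le> dist x y"
      using separate_compact_closed[OF comp[of b c] compact_imp_closed[OF comp[of c a]]] by blast
    have "seg a b \<inter> (seg b c \<union> seg c a) = {}"
      using pos[OF D0(2)] zero[OF D0(2)] by fastforce
    then obtain e where e: "e > 0" "\<And>x y. x \<in> seg a b \<Longrightarrow> y \<in> seg b c \<union> seg c a \<Longrightarrow> e \<le> dist x y"
      using separate_compact_closed[OF comp[of a b] compact_imp_closed[OF compact_Un[OF comp[of b c] comp[of c a]]]]
      by blast
    have "ennreal (\<theta> * ?L) = ennreal (\<theta> * dist a b) + (ennreal (\<theta> * dist b c) + ennreal (\<theta> * dist c a))"
      using \<theta> by (simp add: distrib_left add.assoc flip: ennreal_plus)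
    also have "\<dots> \<le> hausdorff_measure_1 (seg a b) + hausdorff_measure_1 (seg b c \<union> seg c a)"
      unfolding len[symmetric] by (intro add_left_mono hausdorff_measure_1_separated[OF d])
    also have "\<dots> \<le> hausdorff_measure_1 (seg a b \<union> (seg b c \<union> seg c a))"
      by (rule hausdorff_measure_1_separated[OF e])
    also have "\<dots> \<le> hausdorff_measure_1 ?F"
      using sub by (intro hausdorff_measure_1_mono) blast
    finally show "\<theta> * ?L \<le> h" using h by simp
  qed
  moreover have "h \<le> ?L" using le unfolding h(1) by (subst (asm) ennreal_le_iff) auto
  ultimately show ?thesis unfolding perimeter_def fr h_def by simp
qed

section \<open>The isoperimetric inequality for triangles\<close>

text \<open>
  The isoperimetric inequality for triangles: by Heron's formula the squared area is
  \<open>s (s - x) (s - y) (s - z)\<close>, and the last three factors have sum \<open>s\<close>, so their product is at most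
  \<open>(s / 3)\<^sup>3\<close> by the inequality of arithmetic and geometric means.
\<close>

lemma perimeter_squared_triangle_ge:
  assumes "orient a b c \<noteq> 0"
  shows "12 * sqrt 3 \<le> (perimeter (convex hull {a, b, c}))\<^sup>2 / area (convex hull {a, b, c})"
proof -
  define x y z where xyz: "x = dist b c" "y = dist a c" "z = dist a b"
  define s where "s = (x + y + z) / 2"
  let ?V = "area (convex hull {a, b, c})"
  have V: "?V > 0" using assms by (simp add: area_triangle)
  have per: "perimeter (convex hull {a, b, c}) = 2 * s"
    using perimeter_triangle[OF assms] by (simp add: xyz s_def dist_commute)
  have nn: "0 \<le> s - x" "0 \<le> s - y" "0 \<le> s - z"
    using dist_triangle[of a b c] dist_triangle[of a c b] dist_triangle[of b c a]
    by (auto simp: s_def xyz dist_commute)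
  then have s0: "0 \<le> s" by (simp add: xyz s_def)
  have heron: "?V = sqrt (s * (s - x) * (s - y) * (s - z))"
    unfolding area_triangle_eq_content heron by (simp add: xyz s_def)
  have amgm: "27 * (p * q * r) \<le> (p + q + r) ^ 3" if "0 \<le> p" "0 \<le> q" "0 \<le> r" for p q r :: real
  proof -
    \<comment> \<open>the difference as a combination of squares with nonnegative coefficients\<close>
    have "(p + q + r) ^ 3 - 27 * (p * q * r) =
      (p + q + r) * ((p - q)\<^sup>2 + (q - r)\<^sup>2 + (r - p)\<^sup>2) / 2 + 3 * (p * (q - r)\<^sup>2 + q * (r - p)\<^sup>2 + r * (p - q)\<^sup>2)"
      by (simp add: power2_eq_square power3_eq_cube field_simps)
    moreover have "\<dots> \<ge> 0" using that by auto
    ultimately show ?thesis by linarith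
  qed
  have "27 * ((s - x) * (s - y) * (s - z)) \<le> s ^ 3"
    using amgm[OF nn] by (simp add: s_def field_simps)
  then have "s * (27 * ((s - x) * (s - y) * (s - z))) \<le> s * s ^ 3"
    using s0 by (rule mult_left_mono)
  then have "27 * ?V\<^sup>2 \<le> s ^ 4"
    unfolding heron using nn s0 by (simp add: mult_ac power4_eq_xxxx power3_eq_cube)
  then have "(3 * sqrt 3 * ?V)\<^sup>2 \<le> (s\<^sup>2)\<^sup>2"
    by (simp add: power_mult_distrib)
  then have "3 * sqrt 3 * ?V \<le> s\<^sup>2" by (rule power2_le_imp_le) simp
  then show ?thesis using V unfolding per by (simp add: pos_le_divide_eq power_mult_distrib)
qed

section \<open>Bodies around a largest inscribed triangle\<close>

text \<open>
  The area attains its maximum by compactness, and the maximum is positive because \<open>K\<close>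
  contains a small right triangle near an interior point. As \<open>orient\<close> changes sign when two vertices
  are exchanged, maximising the signed area maximises the area.
\<close>

lemma maximal_triangle_exists:
  assumes "convex_body K"
  obtains a b c where "a \<in> K" "b \<in> K" "c \<in> K" "orient a b c > 0"
    "\<And>p q r. p \<in> K \<Longrightarrow> q \<in> K \<Longrightarrow> r \<in> K \<Longrightarrow> orient p q r \<le> orient a b c"
proof -
  have K: "compact K" "interior K \<noteq> {}" using assms by (auto simp: convex_body_def)
  then obtain z e where z: "e > 0" "cball z e \<subseteq> K"
    by (metis all_not_in_conv mem_interior_cball)
  then have "K \<noteq> {}" by (metis centre_in_cball empty_iff less_imp_le subsetD)
  have "compact (K \<times> K \<times> K)" using K by (intro compact_Times)
  moreover have "continuous_on (K \<times> K \<times> K) (\<lambda>(p, q, r). orient p q r)"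
    unfolding case_prod_beta by (intro continuous_intros)
  moreover have "K \<times> K \<times> K \<noteq> {}" using \<open>K \<noteq> {}\<close> by simp
  ultimately obtain m where m: "m \<in> K \<times> K \<times> K"
      "\<forall>n\<in>K \<times> K \<times> K. (\<lambda>(p, q, r). orient p q r) n \<le> (\<lambda>(p, q, r). orient p q r) m"
    using continuous_attains_sup by metis
  then obtain a b c where abc: "a \<in> K" "b \<in> K" "c \<in> K"
    and max: "\<And>p q r. p \<in> K \<Longrightarrow> q \<in> K \<Longrightarrow> r \<in> K \<Longrightarrow> orient p q r \<le> orient a b c"
    by (cases m) auto
  let ?q = "z + e *\<^sub>R axis 1 1" and ?r = "z + e *\<^sub>R axis 2 1"
  have "z \<in> K" "?q \<in> K" "?r \<in> K"
    using z by (auto simp: subset_iff dist_norm)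
  then have "orient z ?q ?r \<le> orient a b c" by (rule max)
  moreover have "orient z ?q ?r = e * e"
    by (simp add: orient_def axis_def)
  ultimately have "orient a b c > 0" using z(1) by (metis less_le_trans mult_pos_pos)
  then show ?thesis using that abc max by blast
qed

text \<open>
  The heart of the proof: \<open>abc\<close> is a regular triangle of side 1 and of largest area among
  the triangles in \<open>K\<close>. Let \<open>s1\<close>, \<open>s2\<close>, \<open>s3\<close> measure, in units of the height, how far \<open>K\<close> reaches beyond
  the three sides, and let \<open>t\<close> be their sum.
  Maximality bounds the coordinates of every \<open>z\<close> in \<open>K\<close> by 1 in absolute value, because replacing a
  vertex by \<open>z\<close> multiplies the signed area by the coordinate of \<open>z\<close> belonging to that vertex; so \<open>K\<close> lies in the hexagon above and its perimeter is at most \<open>3 + t\<close>. The farthest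
  points beyond the sides span caps whose areas are \<open>s1\<close>, \<open>s2\<close>, \<open>s3\<close> times that of \<open>abc\<close>. Finally, the
  half-planes supporting \<open>K\<close> parallel to the sides bound a homothetic copy of \<open>abc\<close> of ratio \<open>1 + t\<close>.

  The bound \<open>t \<le> 5 / 2\<close> keeps \<open>K\<close> away from the large triangle with side 2, for which \<open>t = 3\<close>: it comes from
  the triangle formed by \<open>c\<close> and the farthest points beyond the two sides \<open>bc\<close> and \<open>ab\<close>, whose
  area is at most that of \<open>abc\<close>.
\<close>

lemma normalized_body_bounds:
  assumes K: "convex_body K" and abc: "a \<in> K" "b \<in> K" "c \<in> K"
    and unit: "dist a b = 1" "dist b c = 1" "dist c a = 1" and D: "orient a b c > 0"
    and max: "\<And>p q r. p \<in> K \<Longrightarrow> q \<in> K \<Longrightarrow> r \<in> K \<Longrightarrow> orient p q r \<le> orient a b c"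
  obtains t x where "0 \<le> t" "t \<le> 5 / 2" "perimeter K \<le> 3 + t" "sqrt 3 / 4 * (1 + t) \<le> area K"
    "K \<subseteq> (\<lambda>w. x + (1 + t) *\<^sub>R (w - x)) ` (convex hull {a, b, c})"
proof -
  have cK: "convex K" "compact K" "K \<noteq> {}" using K abc by (auto simp: convex_body_def)
  have cyc: "orient b c a = orient a b c" "orient c a b = orient a b c"
    by (simp_all add: orient_cyclic[of b c a] orient_cyclic[of c a b])
  have D0: "orient a b c \<noteq> 0" "orient b c a \<noteq> 0" "orient c a b \<noteq> 0" using D cyc by simp_all
  have min: "\<exists>p\<in>K. (\<forall>z\<in>K. bary a' b' c' p \<le> bary a' b' c' z \<and> bary a' b' c' z \<le> 1) \<and>
      -1 \<le> bary a' b' c' p \<and> bary a' b' c' p \<le> 0"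
    if h: "a' \<in> K" "b' \<in> K" "c' \<in> K" "orient a' b' c' = orient a b c" for a' b' c'
  proof -
    have nz: "orient a' b' c' > 0" using h D by simp
    obtain p where p: "p \<in> K" "\<And>z. z \<in> K \<Longrightarrow> bary a' b' c' p \<le> bary a' b' c' z"
      using continuous_attains_inf[OF cK(2,3) continuous_on_bary[of a' b' c']] nz by force
    have "bary a' b' c' p \<le> 0" using p(2)[OF h(2)] nz by (simp add: bary_vertex)
    moreover have "bary a' b' c' z \<le> 1" if "z \<in> K" for z
      using max[OF that h(2,3)] h(4) nz by (simp add: bary_def)
    moreover have "-1 \<le> bary a' b' c' p"
      using max[OF p(1) h(3,2)] h(4) nz by (simp add: bary_def orient_swap[of p c' b'] pos_le_divide_eq)
    ultimately show ?thesis using p by blast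
  qed
  obtain p1 where p1: "p1 \<in> K" "\<And>z. z \<in> K \<Longrightarrow> bary a b c p1 \<le> bary a b c z"
      "\<And>z. z \<in> K \<Longrightarrow> bary a b c z \<le> 1" "-1 \<le> bary a b c p1" "bary a b c p1 \<le> 0"
    using min[OF abc refl] by blast
  obtain p2 where p2: "p2 \<in> K" "\<And>z. z \<in> K \<Longrightarrow> bary b c a p2 \<le> bary b c a z"
      "\<And>z. z \<in> K \<Longrightarrow> bary b c a z \<le> 1" "-1 \<le> bary b c a p2" "bary b c a p2 \<le> 0"
    using min[OF abc(2,3,1) cyc(1)] by blast
  obtain p3 where p3: "p3 \<in> K" "\<And>z. z \<in> K \<Longrightarrow> bary c a b p3 \<le> bary c a b z"
      "\<And>z. z \<in> K \<Longrightarrow> bary c a b z \<le> 1" "-1 \<le> bary c a b p3" "bary c a b p3 \<le> 0"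
    using min[OF abc(3,1,2) cyc(2)] by blast
  define s1 s2 s3 where s: "s1 = - bary a b c p1" "s2 = - bary b c a p2" "s3 = - bary c a b p3"
  have s01: "s1 \<in> {0..1}" "s2 \<in> {0..1}" "s3 \<in> {0..1}" using p1 p2 p3 by (auto simp: s)
  define t where "t = s1 + s2 + s3"
  note sum = bary_sum[OF D0(1)]
  have t0: "0 \<le> t" using s01 by (simp add: t_def)
  moreover have "t \<le> 5 / 2"
  proof -
    let ?\<alpha> = "bary a b c p3" and ?\<beta> = "bary b c a p3" and ?\<eta> = "bary b c a p1"
    have ab: "?\<alpha> + ?\<beta> = 1 + s3" using sum[of p3] by (simp add: s)
    have \<alpha>: "s3 \<le> ?\<alpha>" "0 \<le> ?\<alpha>" using ab p2(3)[OF p3(1)] s01 by auto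
    have \<eta>: "s1 \<le> ?\<eta>" using sum[of p1] p3(3)[OF p1(1)] by (simp add: s)
    \<comment> \<open>maximality, applied to the triangle \<open>p3 p1 c\<close>\<close>
    have "orient a b c * (?\<alpha> * ?\<eta> + ?\<beta> * s1) \<le> orient a b c * 1"
      using max[OF p3(1) p1(1) abc(3)] orient_eq_bary[OF D0(1), of p3 p1] by (simp add: s)
    then have "?\<alpha> * ?\<eta> + ?\<beta> * s1 \<le> 1" using D by (simp only: mult_le_cancel_left_pos)
    moreover have "?\<alpha> * s1 \<le> ?\<alpha> * ?\<eta>" using \<alpha> \<eta> by (intro mult_left_mono)
    ultimately have "(?\<alpha> + ?\<beta>) * s1 \<le> 1" by (simp add: distrib_right)
    then have "s1 + s3 * s1 \<le> 1" unfolding ab by (simp add: distrib_right)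
    moreover have "0 \<le> (1 - s1) * (1 - s3)" using s01 by (intro mult_nonneg_nonneg) auto
    then have "s1 + s3 - 1 \<le> s3 * s1" by (simp add: algebra_simps)
    ultimately have "2 * s1 + s3 \<le> 2" by linarith
    then show ?thesis using s01 by (simp add: t_def)
  qed
  moreover have "perimeter K \<le> 3 + t"
    using perimeter_le_hexagon[OF K D unit s01] p1(2,3) p2(2,3) p3(2,3) by (simp add: s t_def)
  moreover have "sqrt 3 / 4 * (1 + t) \<le> area K"
  proof -
    have "area (convex hull {a, b, c}) = sqrt (3 / 16)"
      unfolding area_triangle_eq_content heron using unit by (simp add: dist_commute power2_eq_square)
    then have D2: "orient a b c / 2 = sqrt 3 / 4"
      using D by (simp add: area_triangle real_sqrt_divide)
    have "orient a b c / 2 * (1 - bary a b c p1 - bary b c a p2 - bary c a b p3) \<le> area K"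
      using sum[of p1] sum[of p2] sum[of p3] p1 p2 p3 abc
      by (intro area_ge_triangle_with_caps[OF cK(1,2) D]) (smt (verit) insert_subset empty_subsetI)+
    moreover have "1 - bary a b c p1 - bary b c a p2 - bary c a b p3 = 1 + t"
      by (simp add: s t_def)
    ultimately show ?thesis unfolding D2 by simp
  qed
  \<comment> \<open>\<open>x\<close> is the centre of the homothety; for \<open>t = 0\<close> it is 0, which is as good as any point since
    the ratio is then 1\<close>
  moreover define x where "x = (s1 / t) *\<^sub>R a + (s2 / t) *\<^sub>R b + (s3 / t) *\<^sub>R c"
  have "K \<subseteq> (\<lambda>w. x + (1 + t) *\<^sub>R (w - x)) ` (convex hull {a, b, c})"
  proof
    fix z assume z: "z \<in> K"
    let ?u = "(bary a b c z + s1) / (1 + t)" and ?v = "(bary b c a z + s2) / (1 + t)"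
      and ?w = "(bary c a b z + s3) / (1 + t)"
    let ?y = "?u *\<^sub>R a + ?v *\<^sub>R b + ?w *\<^sub>R c"
    have "0 \<le> ?u" "0 \<le> ?v" "0 \<le> ?w" using p1(2)[OF z] p2(2)[OF z] p3(2)[OF z] t0 by (auto simp: s)
    moreover have "?u + ?v + ?w = 1"
      using sum[of z] t0 by (simp add: t_def flip: add_divide_distrib)
    ultimately have y: "?y \<in> convex hull {a, b, c}" unfolding convex_hull_3 by blast
    have "t *\<^sub>R x = s1 *\<^sub>R a + s2 *\<^sub>R b + s3 *\<^sub>R c"
    proof (cases "t = 0")
      case True
      then have "s1 = 0" "s2 = 0" "s3 = 0" using s01 by (auto simp: t_def)
      then show ?thesis using True by simp
    qed (simp add: x_def scaleR_add_right)
    moreover have "(1 + t) *\<^sub>R ?y = (bary a b c z + s1) *\<^sub>R a + (bary b c a z + s2) *\<^sub>R b + (bary c a b z + s3) *\<^sub>R c"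
      using t0 by (simp add: scaleR_add_right)
    ultimately have "(1 + t) *\<^sub>R ?y - t *\<^sub>R x = z"
      using bary_expand[OF D0(1), of z] by (simp add: algebra_simps)
    then have "z = x + (1 + t) *\<^sub>R (?y - x)" by (simp add: algebra_simps)
    then show "z \<in> (\<lambda>w. x + (1 + t) *\<^sub>R (w - x)) ` (convex hull {a, b, c})"
      using y by blast
  qed
  ultimately show ?thesis using that by blast
qed

section \<open>Affine normalisation and the Banach--Mazur distance\<close>

text \<open>
  With the two edge vectors at a vertex as bases, this makes a triangle regular, and it
  identifies any two triangles up to affine maps.
\<close>

lemma matrix_taking_frame:
  fixes u v u' v' :: "real^2"
  assumes "orient 0 u v \<noteq> 0" "orient 0 u' v' \<noteq> 0"
  obtains A :: "real^2^2" where "invertible A" "A *v u = u'" "A *v v = v'"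
proof -
  \<comment> \<open>the matrix with columns \<open>u\<close> and \<open>v\<close>\<close>
  define F where "F = (\<lambda>u v :: real^2. transpose (vector [u, v]) :: real^2^2)"
  have F: "F u v *v axis 1 1 = u" "F u v *v axis 2 1 = v" for u v
    by (simp_all add: F_def vec_eq_iff matrix_vector_mult_def transpose_def axis_def sum_2)
  have inv: "invertible (F u v)" if "orient 0 u v \<noteq> 0" for u v
    using that by (simp add: F_def invertible_det_nz det_2 transpose_def orient_def algebra_simps)
  obtain G where G: "F u v ** G = mat 1" "G ** F u v = mat 1"
    using inv[OF assms(1)] unfolding invertible_def by blast
  then have "invertible G" unfolding invertible_def by blast
  define A where "A = F u' v' ** G"
  have "A *v u = u'" "A *v v = v'"
    using G(2) unfolding A_def
    by (metis F(1) matrix_vector_mul_assoc matrix_vector_mul_lid,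
        metis F(2) matrix_vector_mul_assoc matrix_vector_mul_lid)
  moreover have "invertible A" unfolding A_def using \<open>invertible G\<close> inv[OF assms(2)] by (intro invertible_mult)
  ultimately show ?thesis using that by blast
qed

lemma convex_body_linear_image:
  assumes "convex_body K" "invertible A"
  shows "convex_body ((*v) A ` K)"
proof -
  have "interior ((*v) A ` K) = (*v) A ` interior K"
    using assms(2) by (intro interior_injective_linear_image inj_matrix_vector_mult) auto
  moreover have "compact ((*v) A ` K)"
    using assms(1) unfolding convex_body_def
    by (intro compact_continuous_image linear_continuous_on matrix_vector_mul_bounded_linear) auto
  ultimately show ?thesis
    using assms(1) unfolding convex_body_def by (auto intro: convex_linear_image)
qed

lemma orient_linear_image: "orient (A *v p) (A *v q) (A *v r) = det A * orient p q r"
  unfolding orient_def det_2 matrix_vector_mult_def sum_2 by (simp add: sum_2) algebra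

lemma orient_translate: "orient p q r = orient 0 (q - p) (r - p)"
  by (simp add: orient_def)

text \<open>
  All triangles are affinely equivalent, so the triangle \<open>a'b'c'\<close> can be placed exactly on the enlarged
  copy of \<open>abc\<close>, which is squeezed between \<open>K\<close> and the image of \<open>K\<close> under the homothety.
\<close>

lemma banach_mazur_triangle_le:
  assumes abc: "convex hull {a, b, c} \<subseteq> K" "orient a b c \<noteq> 0" and D': "orient a' b' c' \<noteq> 0"
    and l: "1 \<le> l" and K: "K \<subseteq> (\<lambda>w. x + l *\<^sub>R (w - x)) ` (convex hull {a, b, c})"
  shows "banach_mazur K (convex hull {a', b', c'}) \<le> ln l"
proof -
  have "orient 0 (l *\<^sub>R (b - a)) (l *\<^sub>R (c - a)) = l * l * orient a b c"
    by (simp add: orient_def algebra_simps)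
  then have "orient 0 (l *\<^sub>R (b - a)) (l *\<^sub>R (c - a)) \<noteq> 0" using abc(2) l by simp
  moreover have "orient 0 (b' - a') (c' - a') \<noteq> 0" using D' orient_translate[of a' b' c'] by simp
  ultimately obtain A where A: "invertible A" "A *v (b' - a') = l *\<^sub>R (b - a)"
      "A *v (c' - a') = l *\<^sub>R (c - a)"
    using matrix_taking_frame by metis
  obtain A' where "A ** A' = mat 1" using A(1) by (auto simp: invertible_def)
  then have A': "A *v (A' *v w) = w" for w by (simp add: matrix_vector_mul_assoc)
  \<comment> \<open>the shift for which \<open>A\<close> sends \<open>a' - y\<close> to \<open>l (a - x)\<close>\<close>
  define y where "y = a' - A' *v (l *\<^sub>R (a - x))"
  have img: "(*v) A ` ((\<lambda>z. z - y) ` (convex hull {a', b', c'})) =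
      (\<lambda>w. l *\<^sub>R (w - x)) ` (convex hull {a, b, c})" (is "?L = ?R")
  proof -
    have "A *v (a' - y) = l *\<^sub>R (a - x)" by (simp add: y_def A')
    then have *: "A *v (a' + u *\<^sub>R (b' - a') + v *\<^sub>R (c' - a') - y) =
        l *\<^sub>R (a + u *\<^sub>R (b - a) + v *\<^sub>R (c - a) - x)" for u v
    proof -
      have "A *v (a' + u *\<^sub>R (b' - a') + v *\<^sub>R (c' - a') - y) =
          A *v (a' - y) + u *\<^sub>R (A *v (b' - a')) + v *\<^sub>R (A *v (c' - a'))"
        by (simp add: algebra_simps)
      also have "\<dots> = l *\<^sub>R (a + u *\<^sub>R (b - a) + v *\<^sub>R (c - a) - x)"
        unfolding A(2,3) \<open>A *v (a' - y) = _\<close> by (simp add: algebra_simps)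
      finally show ?thesis .
    qed
    have "?L = {A *v (a' + u *\<^sub>R (b' - a') + v *\<^sub>R (c' - a') - y) | u v. 0 \<le> u \<and> 0 \<le> v \<and> u + v \<le> 1}"
      unfolding convex_hull_3_alt by blast
    also have "\<dots> = ?R"
      unfolding * convex_hull_3_alt by blast
    finally show ?thesis .
  qed
  let ?S = "{l :: real. 1 \<le> l \<and> (\<exists>(A :: real^2^2) x y. invertible A \<and>
        (\<lambda>z. z - x) ` K \<subseteq> (*v) A ` ((\<lambda>z. z - y) ` (convex hull {a', b', c'})) \<and>
        (*v) A ` ((\<lambda>z. z - y) ` (convex hull {a', b', c'})) \<subseteq> (*\<^sub>R) l ` ((\<lambda>z. z - x) ` K))}"
  have "(\<lambda>z. z - x) ` K \<subseteq> (\<lambda>w. l *\<^sub>R (w - x)) ` (convex hull {a, b, c})" by (auto dest!: subsetD[OF K])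
  moreover have "(\<lambda>w. l *\<^sub>R (w - x)) ` (convex hull {a, b, c}) \<subseteq> (*\<^sub>R) l ` ((\<lambda>z. z - x) ` K)"
    using abc(1) by auto
  ultimately have lS: "l \<in> ?S" using l A(1) unfolding img[symmetric] by blast
  have bd: "bdd_below ?S" by (intro bdd_belowI[of _ 1]) auto
  have "1 \<le> Inf ?S" using lS by (intro cInf_greatest) auto
  moreover have "Inf ?S \<le> l" using lS bd by (rule cInf_lower)
  ultimately show ?thesis unfolding banach_mazur_def by simp
qed

lemma ir_le:
  assumes "invertible A"
  shows "ir K \<le> (perimeter ((*v) A ` K))\<^sup>2 / area ((*v) A ` K)"
  unfolding ir_def
proof (rule cINF_lower)
  show "bdd_below ((\<lambda>A. (perimeter ((*v) A ` K))\<^sup>2 / area ((*v) A ` K)) ` {A :: real^2^2. invertible A})"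
    by (intro bdd_belowI2[of _ 0]) (simp add: area_def)
qed (use assms in simp)

lemma ir_triangle_ge:
  assumes "orient a b c \<noteq> 0"
  shows "12 * sqrt 3 \<le> ir (convex hull {a, b, c})"
  unfolding ir_def
proof (rule cINF_greatest)
  show "{A :: real^2^2. invertible A} \<noteq> {}" 
    by (auto simp: invertible_def intro!: exI[of _ "mat 1"])
next
  fix A :: "real^2^2" assume "A \<in> {A. invertible A}"
  then have "orient (A *v a) (A *v b) (A *v c) \<noteq> 0"
    using assms by (simp add: orient_linear_image invertible_det_nz)
  moreover have "(*v) A ` (convex hull {a, b, c}) = convex hull {A *v a, A *v b, A *v c}"
    by (simp add: convex_hull_linear_image)
  ultimately show "12 * sqrt 3 \<le> (perimeter ((*v) A ` (convex hull {a, b, c})))\<^sup>2 / area ((*v) A ` (convex hull {a, b, c}))"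
    using perimeter_squared_triangle_ge by simp
qed

text \<open>
  The two bounds give \<open>S\<^sup>2 / V \<le> (4 / \<surd>3) (3 + t)\<^sup>2 / (1 + t)\<close>, which falls short of \<open>12 \<surd>3\<close> by the relative amount
  \<open>t (3 - t) / (9 (1 + t))\<close>. This vanishes at \<open>t = 0\<close> and \<open>t = 3\<close>, and on \<open>[\<epsilon>, 5 / 2]\<close> it is at least
  \<open>\<epsilon> / 72\<close>: for \<open>t \<le> 1\<close> it is at least \<open>t / 9\<close>, and beyond 1 the inequality
  \<open>(t - 1) (5 / 2 - t) \<ge> 0\<close> implies \<open>8 t (3 - t) \<ge> 1 + t\<close>.
\<close>

lemma isoperimetric_ratio_estimate:
  fixes t \<epsilon> :: real
  assumes \<epsilon>: "0 \<le> \<epsilon>" "\<epsilon> < 1" and t: "\<epsilon> \<le> t" "t \<le> 5 / 2"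
    and S: "0 \<le> S" "S \<le> 3 + t" and V: "sqrt 3 / 4 * (1 + t) \<le> V"
  shows "S\<^sup>2 / V \<le> (1 - 1 / 72 * \<epsilon>) * (12 * sqrt 3)"
proof -
  have t0: "0 \<le> t" using \<epsilon> t by simp
  have q: "12 * sqrt 3 * (sqrt 3 / 4 * (1 + t)) = 9 * (1 + t)"
  proof -
    have "12 * sqrt 3 * (sqrt 3 / 4 * (1 + t)) = 3 * (sqrt 3 * sqrt 3) * (1 + t)" by simp
    then show ?thesis by simp
  qed
  have "\<epsilon> * (1 + t) \<le> 8 * (t * (3 - t))"
  proof (cases "t \<le> 1")
    case True
    have "\<epsilon> * (1 + t) \<le> t * (8 * (3 - t))" using True t t0 \<epsilon> by (intro mult_mono) auto
    then show ?thesis by (simp only: mult.left_commute)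
  next
    case False
    have "\<epsilon> * (1 + t) \<le> 1 * (1 + t)" using \<epsilon> t0 by (intro mult_right_mono) auto
    moreover have "0 \<le> (t - 1) * (5 / 2 - t)" using False t by (intro mult_nonneg_nonneg) auto
    then have "t * t \<le> 7 / 2 * t - 5 / 2" by (simp add: field_simps)
    then have "1 + t \<le> 24 * t - 8 * (t * t)" using t(2) by linarith
    moreover have "8 * (t * (3 - t)) = 24 * t - 8 * (t * t)" by (simp add: algebra_simps)
    ultimately show ?thesis by simp
  qed
  \<comment> \<open>\<open>(3 + t)\<^sup>2 = 9 (1 + t) - t (3 - t)\<close>\<close>
  then have key: "(3 + t)\<^sup>2 \<le> 9 * ((1 - 1 / 72 * \<epsilon>) * (1 + t))"
    by (simp add: power2_eq_square field_simps)
  have Vpos: "0 < sqrt 3 / 4 * (1 + t)" using t0 by simp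
  have "S\<^sup>2 \<le> (3 + t)\<^sup>2" using S by (intro power_mono)
  also have "\<dots> \<le> 9 * ((1 - 1 / 72 * \<epsilon>) * (1 + t))" by (rule key)
  also have "\<dots> = (1 - 1 / 72 * \<epsilon>) * (12 * sqrt 3) * (sqrt 3 / 4 * (1 + t))"
    unfolding mult.assoc[of "1 - 1 / 72 * \<epsilon>"] q by (rule mult.left_commute)
  also have "\<dots> \<le> (1 - 1 / 72 * \<epsilon>) * (12 * sqrt 3) * V"
    using \<epsilon> V by (intro mult_left_mono) auto
  finally show ?thesis using Vpos V by (simp add: pos_divide_le_eq)
qed

section \<open>The stability theorem\<close>

theorem theorem1p4:
  fixes K T :: "(real^2) set" and \<epsilon> :: real
  assumes "convex_body K"
    and "regular_triangle_circumscribing_unit_disc T"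
    and "0 \<le> \<epsilon>" and "\<epsilon> < 1"
    and "\<epsilon> \<le> banach_mazur K T"
  shows "ir K \<le> (1 - 1 / (2 ^ 3 * 3 ^ 2) * \<epsilon>) * ir T"
proof -
  obtain a' b' c' where T: "T = convex hull {a', b', c'}" and disc: "cball 0 1 \<subseteq> T"
    using assms(2) unfolding regular_triangle_circumscribing_unit_disc_def by blast
  \<comment> \<open>the disc gives the triangle positive area\<close>
  have "measure lebesgue (cball (0 :: real^2) 1) \<le> area T"
    unfolding area_def T using disc T
    by (intro measure_mono_fmeasurable lmeasurable_compact finite_imp_compact_convex_hull) auto
  moreover have "measure lebesgue (cball (0 :: real^2) 1) > 0"
    using content_cball_pos[of 1 "0 :: real^2"] by simp
  ultimately have "0 < area T" by linarith
  then have D': "orient a' b' c' \<noteq> 0" unfolding T area_triangle by auto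

  obtain p q r where pqr: "p \<in> K" "q \<in> K" "r \<in> K" "orient p q r > 0"
    and max: "\<And>p' q' r'. p' \<in> K \<Longrightarrow> q' \<in> K \<Longrightarrow> r' \<in> K \<Longrightarrow> orient p' q' r' \<le> orient p q r"
    using maximal_triangle_exists[OF assms(1)] by blast
  \<comment> \<open>two edge vectors of a regular triangle of side 1\<close>
  define e f :: "real^2" where ef: "e = vector [1, 0]" "f = vector [1 / 2, sqrt 3 / 2]"
  have "orient 0 (q - p) (r - p) \<noteq> 0" using pqr(4) orient_translate[of p q r] by simp
  moreover
  have oef: "orient 0 e f = sqrt 3 / 2" by (simp add: ef orient_def)
  then have "orient 0 e f \<noteq> 0" by (metis divide_eq_0_iff real_sqrt_eq_zero_cancel_iff zero_neq_numeral)
  ultimately obtain A where A: "invertible A" "A *v (q - p) = e" "A *v (r - p) = f"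
    using matrix_taking_frame[of "q - p" "r - p" e f] by blast
  let ?L = "(*v) A ` K"
  let ?a = "A *v p" and ?b = "A *v q" and ?c = "A *v r"
  have bc: "?b = ?a + e" "?c = ?a + f" using A(2,3) by (simp_all add: algebra_simps)
  have unit: "dist ?a ?b = 1" "dist ?b ?c = 1" "dist ?c ?a = 1"
    unfolding bc by (simp_all add: dist_norm norm_vec_def L2_set_def sum_2 ef power2_eq_square)
  have "orient ?a ?b ?c = sqrt 3 / 2"
    unfolding bc using oef orient_translate[of ?a "?a + e" "?a + f"] by simp
  moreover have "sqrt 3 / 2 > (0::real)" by simp
  ultimately have D: "orient ?a ?b ?c > 0" by (simp only:)
  have detA: "det A > 0"
    using D pqr(4) by (simp add: orient_linear_image zero_less_mult_iff)
  have maxL: "orient p' q' r' \<le> orient ?a ?b ?c" if "p' \<in> ?L" "q' \<in> ?L" "r' \<in> ?L" for p' q' r'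
    using that max detA by (auto simp: orient_linear_image)
  have L: "convex_body ?L" using assms(1) A(1) by (rule convex_body_linear_image)
  obtain t x where t: "0 \<le> t" "t \<le> 5 / 2" "perimeter ?L \<le> 3 + t" "sqrt 3 / 4 * (1 + t) \<le> area ?L"
    "?L \<subseteq> (\<lambda>w. x + (1 + t) *\<^sub>R (w - x)) ` (convex hull {?a, ?b, ?c})"
    using normalized_body_bounds[OF L _ _ _ unit D maxL] pqr by blast

  \<comment> \<open>the homothety is pulled back from \<open>A K\<close> to \<open>K\<close>\<close>
  obtain B where B: "B ** A = mat 1" "A ** B = mat 1" using A(1) by (auto simp: invertible_def)
  then have BA: "B *v (A *v w) = w" for w by (simp add: matrix_vector_mul_assoc)
  have hull: "convex hull {?a, ?b, ?c} = (*v) A ` (convex hull {p, q, r})"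
    by (simp add: convex_hull_linear_image)
  have "K \<subseteq> (\<lambda>w. B *v x + (1 + t) *\<^sub>R (w - B *v x)) ` (convex hull {p, q, r})"
  proof
    fix z assume "z \<in> K"
    then obtain w where w: "w \<in> convex hull {p, q, r}" "A *v z = x + (1 + t) *\<^sub>R (A *v w - x)"
      using t(5) unfolding hull by blast
    have "z = B *v (A *v z)" by (simp add: BA)
    also have "\<dots> = B *v x + (1 + t) *\<^sub>R (w - B *v x)"
      unfolding w(2) by (simp add: matrix_vector_right_distrib matrix_vector_mult_scaleR
          matrix_vector_mult_diff_distrib BA)
    finally show "z \<in> (\<lambda>w. B *v x + (1 + t) *\<^sub>R (w - B *v x)) ` (convex hull {p, q, r})"
      using w(1) by blast
  qed
  moreover have "convex hull {p, q, r} \<subseteq> K"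
    using pqr assms(1) by (intro hull_minimal) (auto simp: convex_body_def)
  ultimately have "banach_mazur K T \<le> ln (1 + t)"
    unfolding T using pqr(4) D' t(1) by (intro banach_mazur_triangle_le[of p q r]) auto
  also have "\<dots> \<le> t" using t(1) by (rule ln_add_one_self_le_self)
  finally have "\<epsilon> \<le> t" using assms(5) by simp
  have "ir K \<le> (perimeter ?L)\<^sup>2 / area ?L" using A(1) by (rule ir_le)
  also have "\<dots> \<le> (1 - 1 / 72 * \<epsilon>) * (12 * sqrt 3)"
    using isoperimetric_ratio_estimate[OF assms(3,4) \<open>\<epsilon> \<le> t\<close> t(2) _ t(3,4)]
    by (simp add: perimeter_def)
  also have "\<dots> \<le> (1 - 1 / 72 * \<epsilon>) * ir T"
    unfolding T using assms(4) ir_triangle_ge[OF D'] by (intro mult_left_mono) auto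
  finally show ?thesis by simp
qed

end
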